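(* (Newton's identities.) Let $M$ be an $(m+n)\times(m+n)$ $q$-super Manin matrix, and define the formal power series in $t$ $$S(t)=\sum_{k=0}^\infty t^k\,\mathrm{str}_{1,\dots,k}\mathcal{H}_k^qM_1\cdots M_k,\quad A(t)=\sum_{k=0}^\infty(-t)^k\,\mathrm{str}_{1,\dots,k}\mathcal{A}_k^qM_1\cdots M_k,\quad T(t)=\sum_{k=0}^\infty t^k\,\mathrm{str}\,M^{[k+1]} .$$ Then $$\partial_tA(t)=-A(t)T(t),\qquad \partial_tS(t)=T(t)S(t).$$
   Context: Let $q$ be a nonzero parameter and $m,n\ge 0$ integers. $\mathbb{C}^{m|n}$ is the $\mathbb{Z}_2$-graded space with basis $e_1,\dots,e_{m+n}$, where $e_i$ has parity $\bar i=0$ for $i\le m$ and $\bar i=1$ for $i>m$; the matrix units $E_{ij}$ have parity $\bar i+\bar j$. Put $\varepsilon(a)=1,0,-1$ according to $a>0$, $a=0$, $a<0$. Tensor products of superalgebras use the sign rule $(a\otimes b)(c\otimes d)=(-1)^{\bar b\bar c}ac\otimes bd$. Define $P^q=\sum_{i,j=1}^{m+n}q^{\varepsilon(i-j)}(-1)^{\bar j}E_{ij}\otimes E_{ji}$. It satisfies $(P^q)^2=1$ and the braid relation. Let $P^q_{a,a+1}\in\mathrm{End}(\mathbb{C}^{m|n})^{\otimes k}$ be $P^q$ placed in the tensor factors $a,a+1$. For $\sigma\in\mathfrak{S}_k$ with reduced decomposition $\sigma=s_{i_1}\cdots s_{i_l}$, $s_i=(i,i+1)$, put $P_\sigma^q=P^q_{i_1,i_1+1}\cdots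 P^q_{i_l,i_l+1}$, and $$\mathcal{A}_k^q=\frac1{k!}\sum_{\sigma\in\mathfrak{S}_k}\mathrm{sgn}(\sigma)P^q_\sigma,\qquad \mathcal{H}_k^q=\frac1{k!}\sum_{\sigma\in\mathfrak{S}_k}P^q_\sigma .$$ Let $\mathcal{R}$ be a unital associative superalgebra and $A=(A_{ij})$ an $(m+n)\times(m+n)$ matrix over $\mathcal{R}$ with $A_{ij}$ of parity $\bar i+\bar j$. Such $A$ is identified with $\sum_{i,j}(-1)^{\bar i\bar j+\bar j}A_{ij}\otimes E_{ij}$, and for $1\le a\le k$ we put $$A_a=\sum_{i,j}(-1)^{\bar i\bar j+\bar j}A_{ij}\otimes 1^{\otimes(a-1)}\otimes E_{ij}\otimes 1^{\otimes(k-a)}\in\mathcal{R}\otimes\mathrm{End}(\mathbb{C}^{m|n})^{\otimes k}.$$ $M$ is a $q$-super Manin matrix if $(1-P^q)M_1M_2(1+P^q)=0$. The supertrace of a matrix is $\mathrm{str}(A)=\sum_i(-1)^{\bar i}A_{ii}$ (equivalently, $\mathrm{str}(E_{ij})=\delta_{ij}(-1)^{\bar i}$ under the identification above); $\mathrm{str}_a$ is the supertrace over the $a$-th copy of $\mathrm{End}(\mathbb{C}^{m|n})$ (identity on the other factors), and $\mathrm{str}_{1,\dots,k}$ is the supertrace over all copies $1,\dots,k$. The $k=0$ terms of $S(t)$ and $A(t)$ are $1$. For matrices $B,C$ put $B*C=\mathrm{str}_1P^q_{12}B_1C_2$ (again regarded as a matrix), and define $M^{[0]}=1$, $M^{[1]}=M$,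 $M^{[k]}=M^{[k-1]}*M$ for $k>1$. *)

theory Defs
  imports
    Complex_Main
    "HOL-Library.Z2"
    "HOL-Library.Function_Algebras"
    "HOL-Combinatorics.Permutations"
    "HOL-Computational_Algebra.Formal_Power_Series"
begin

text \<open>
  Parities live in the two-element field \<^typ>\<open>bit\<close>; \<open>ksgn b\<close> is \<open>(-1)\<close> to the power \<open>b\<close>.
\<close>

definition ksgn :: "bit \<Rightarrow> 'a::ring_1"
  where "ksgn b = (if b = 0 then 1 else - 1)"

locale superalgebra = vector_space scale
  for scale :: "complex \<Rightarrow> 'r::ring_1 \<Rightarrow> 'r" +
  fixes grade :: "bit \<Rightarrow> 'r set"
  assumes scale_mult_left: "scale c (x * y) = scale c x * y"
    and scale_mult_right: "scale c (x * y) = x * scale c y"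
    and subspace_grade: "subspace (grade b)"
    and grade_sum: "\<exists>u\<in>grade 0. \<exists>v\<in>grade 1. x = u + v"
    and grade_inter: "grade 0 \<inter> grade 1 = {0}"
    and one_in_grade: "1 \<in> grade 0"
    and mult_in_grade: "\<lbrakk>x \<in> grade b; y \<in> grade b'\<rbrakk> \<Longrightarrow> x * y \<in> grade (b + b')"

text \<open>
  An element of \<open>R \<otimes> End(C^{m|n})^{\<otimes>k}\<close> is stored as its coefficient family with respect to the
  matrix unit basis: the value \<open>X I J\<close> at index lists \<open>I, J\<close> of length \<open>k\<close> over \<open>{1..m + n}\<close> is the
  coefficient in \<open>R\<close> of \<open>E_{I!0,J!0} \<otimes> \<dots> \<otimes> E_{I!(k-1),J!(k-1)}\<close>, and all other values are \<open>0\<close>.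
  Zero, sum and difference are the pointwise ones of \<^theory>\<open>HOL-Library.Function_Algebras\<close>; the
  product and unit of that theory are not used, see \<open>tmul\<close> and \<open>tone\<close> below.
\<close>

type_synonym 'r tensor = "nat list \<Rightarrow> nat list \<Rightarrow> 'r"

locale q_super = superalgebra scale grade
  for scale :: "complex \<Rightarrow> 'r::ring_1 \<Rightarrow> 'r" and grade :: "bit \<Rightarrow> 'r set" +
  fixes m n :: nat and q :: complex
  assumes q_nonzero: "q \<noteq> 0"
begin

definition par :: "nat \<Rightarrow> bit"
  where "par i = (if i \<le> m then 0 else 1)"

definition indices :: "nat \<Rightarrow> nat list set"
  where "indices k = {I. length I = k \<and> set I \<subseteq> {1..m + n}}"

definition hcomp :: "bit \<Rightarrow> 'r \<Rightarrow> 'r"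
  where "hcomp b y = (THE u. u \<in> grade b \<and> y - u \<in> grade (b + 1))"

text \<open>
  For \<open>k\<close>-fold products the sign rule gives
  \<open>(x \<otimes> a_1 \<otimes> \<dots> \<otimes> a_k) (y \<otimes> b_1 \<otimes> \<dots> \<otimes> b_k) = \<plusminus> x y \<otimes> a_1 b_1 \<otimes> \<dots> \<otimes> a_k b_k\<close>, where the exponent of
  \<open>-1\<close> collects \<open>|a_p| |y|\<close> for all \<open>p\<close> and \<open>|a_p| |b_r|\<close> for all \<open>r < p\<close>. Below \<open>a_p\<close> is the matrix
  unit with indices \<open>I!p, K!p\<close> and \<open>b_p\<close> the one with indices \<open>K!p, J!p\<close>; other pairs of basis
  elements multiply to \<open>0\<close>. The coefficient \<open>Y K J\<close> need not be homogeneous, so it is split into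
  its two homogeneous components.
\<close>

definition tmul :: "'r tensor \<Rightarrow> 'r tensor \<Rightarrow> 'r tensor"  (infixl \<open>\<star>\<close> 70)
  where "X \<star> Y = (\<lambda>I J. if length J = length I
     then \<Sum>K\<in>indices (length I). \<Sum>b\<in>{0, 1}.
        ksgn ((\<Sum>p<length I. par (I ! p) + par (K ! p)) * b
            + (\<Sum>p<length I. \<Sum>r<p. (par (I ! p) + par (K ! p)) * (par (K ! r) + par (J ! r))))
        * (X I K * hcomp b (Y K J))
     else 0)"

text \<open>\<open>ptens x [a\<^sub>1, \<dots>, a\<^sub>k]\<close> is \<open>x \<otimes> a\<^sub>1 \<otimes> \<dots> \<otimes> a\<^sub>k\<close> for complex matrices \<open>a\<^sub>p\<close>.\<close>

definition ptens :: "'r \<Rightarrow> (nat \<Rightarrow> nat \<Rightarrow> complex) list \<Rightarrow> 'r tensor"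
  where "ptens x as = (\<lambda>I J. if length I = length as \<and> length J = length as
     then scale (\<Prod>p<length as. (as ! p) (I ! p) (J ! p)) x else 0)"

definition munit :: "nat \<Rightarrow> nat \<Rightarrow> nat \<Rightarrow> nat \<Rightarrow> complex"
  where "munit i j = (\<lambda>a b. if a = i \<and> b = j then 1 else 0)"

definition mid :: "nat \<Rightarrow> nat \<Rightarrow> complex"
  where "mid = (\<Sum>i\<in>{1..m + n}. munit i i)"

definition tone :: "nat \<Rightarrow> 'r tensor"
  where "tone k = ptens 1 (replicate k mid)"

definition tscale :: "complex \<Rightarrow> 'r tensor \<Rightarrow> 'r tensor"
  where "tscale c X = (\<lambda>I J. scale c (X I J))"

definition Pq :: "nat \<Rightarrow> nat \<Rightarrow> 'r tensor"
  where "Pq k a = (\<Sum>i\<in>{1..m + n}. \<Sum>j\<in>{1..m + n}.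
     tscale (q powi sgn (int i - int j) * ksgn (par j))
       (ptens 1 (replicate (a - 1) mid @ [munit i j, munit j i] @ replicate (k - a - 1) mid)))"

definition word_for :: "nat \<Rightarrow> (nat \<Rightarrow> nat) \<Rightarrow> nat list \<Rightarrow> bool"
  where "word_for k \<sigma> w \<longleftrightarrow> set w \<subseteq> {1..<k} \<and> foldr (\<lambda>i f. transpose i (i + 1) \<circ> f) w id = \<sigma>"

definition reduced_word :: "nat \<Rightarrow> (nat \<Rightarrow> nat) \<Rightarrow> nat list \<Rightarrow> bool"
  where "reduced_word k \<sigma> w \<longleftrightarrow>
     word_for k \<sigma> w \<and> (\<forall>w'. word_for k \<sigma> w' \<longrightarrow> length w \<le> length w')"

text \<open>
  By the braid relation \<open>Pperm k \<sigma>\<close> does not depend on which reduced decomposition is chosen.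
\<close>

definition Pperm :: "nat \<Rightarrow> (nat \<Rightarrow> nat) \<Rightarrow> 'r tensor"
  where "Pperm k \<sigma> = foldr (\<lambda>i X. Pq k i \<star> X) (SOME w. reduced_word k \<sigma> w) (tone k)"

definition Asym :: "nat \<Rightarrow> 'r tensor"
  where "Asym k = tscale (1 / fact k)
     (\<Sum>\<sigma> | \<sigma> permutes {1..k}. tscale (of_int (sign \<sigma>)) (Pperm k \<sigma>))"

definition Hsym :: "nat \<Rightarrow> 'r tensor"
  where "Hsym k = tscale (1 / fact k) (\<Sum>\<sigma> | \<sigma> permutes {1..k}. Pperm k \<sigma>)"

text \<open>
  Matrices over \<open>R\<close> are functions of which only the entries with indices in \<open>{1..m + n}\<close> matter.
  \<open>place k a B\<close> is \<open>B\<^sub>a\<close> inside the \<open>k\<close>-fold tensor product.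
\<close>

definition super_matrix :: "(nat \<Rightarrow> nat \<Rightarrow> 'r) \<Rightarrow> bool"
  where "super_matrix B \<longleftrightarrow>
     (\<forall>i\<in>{1..m + n}. \<forall>j\<in>{1..m + n}. B i j \<in> grade (par i + par j))"

definition place :: "nat \<Rightarrow> nat \<Rightarrow> (nat \<Rightarrow> nat \<Rightarrow> 'r) \<Rightarrow> 'r tensor"
  where "place k a B = (\<Sum>i\<in>{1..m + n}. \<Sum>j\<in>{1..m + n}.
     tscale (ksgn (par i * par j + par j))
       (ptens (B i j) (replicate (a - 1) mid @ [munit i j] @ replicate (k - a) mid)))"

definition place_prod :: "nat \<Rightarrow> (nat \<Rightarrow> nat \<Rightarrow> 'r) \<Rightarrow> 'r tensor"
  where "place_prod k B = foldr (\<lambda>a X. place k a B \<star> X) [1..<k + 1] (tone k)"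

definition q_super_manin :: "(nat \<Rightarrow> nat \<Rightarrow> 'r) \<Rightarrow> bool"
  where "q_super_manin B \<longleftrightarrow> super_matrix B \<and>
     (tone 2 - Pq 2 1) \<star> place 2 1 B \<star> place 2 2 B \<star> (tone 2 + Pq 2 1) = 0"

text \<open>
  \<open>str_first\<close> is the supertrace over the first copy, the remaining copies being renumbered;
  iterating it \<open>k\<close> times leaves an element of \<open>R\<close>, the coefficient at the empty index lists.
\<close>

definition str_first :: "'r tensor \<Rightarrow> 'r tensor"
  where "str_first X = (\<lambda>I J. \<Sum>i\<in>{1..m + n}. ksgn (par i) * X (i # I) (i # J))"

definition str_all :: "nat \<Rightarrow> 'r tensor \<Rightarrow> 'r"
  where "str_all k X = (str_first ^^ k) X [] []"

definition str :: "(nat \<Rightarrow> nat \<Rightarrow> 'r) \<Rightarrow> 'r"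
  where "str B = (\<Sum>i\<in>{1..m + n}. ksgn (par i) * B i i)"

text \<open>
  The inverse of the identification of a matrix \<open>B\<close> with \<open>place 1 1 B\<close>.
\<close>

definition matrix_of :: "'r tensor \<Rightarrow> nat \<Rightarrow> nat \<Rightarrow> 'r"
  where "matrix_of X = (\<lambda>i j. ksgn (par i * par j + par j) * X [i] [j])"

definition mstar :: "(nat \<Rightarrow> nat \<Rightarrow> 'r) \<Rightarrow> (nat \<Rightarrow> nat \<Rightarrow> 'r) \<Rightarrow> (nat \<Rightarrow> nat \<Rightarrow> 'r)"
  where "mstar B C = matrix_of (str_first (Pq 2 1 \<star> place 2 1 B \<star> place 2 2 C))"

fun mpow :: "(nat \<Rightarrow> nat \<Rightarrow> 'r) \<Rightarrow> nat \<Rightarrow> (nat \<Rightarrow> nat \<Rightarrow> 'r)"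
  where
    "mpow B 0 = (\<lambda>i j. if i = j then 1 else 0)"
  | "mpow B (Suc 0) = B"
  | "mpow B (Suc (Suc k)) = mstar (mpow B (Suc k)) B"

definition S_series :: "(nat \<Rightarrow> nat \<Rightarrow> 'r) \<Rightarrow> 'r fps"
  where "S_series B = Abs_fps (\<lambda>k. str_all k (Hsym k \<star> place_prod k B))"

definition A_series :: "(nat \<Rightarrow> nat \<Rightarrow> 'r) \<Rightarrow> 'r fps"
  where "A_series B = Abs_fps (\<lambda>k. (- 1) ^ k * str_all k (Asym k \<star> place_prod k B))"

definition T_series :: "(nat \<Rightarrow> nat \<Rightarrow> 'r) \<Rightarrow> 'r fps"
  where "T_series B = Abs_fps (\<lambda>k. str (mpow B (k + 1)))"

end

end

theory Submission
  imports Defs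
begin

text \<open>
  Write \<open>\<tau>\<^sub>k(\<sigma>)\<close> for the supertrace of \<open>P\<^sub>\<sigma> M\<^sub>1 \<dots> M\<^sub>k\<close>. Three facts about these functionals imply both
  identities. The Manin condition, multiplied by \<open>P\<^sub>\<sigma>\<close> and traced, gives the exchange relation
  \<open>\<tau>(\<sigma>) + \<tau>(s\<^sub>b \<sigma>) = \<tau>(\<sigma> s\<^sub>b) + \<tau>(s\<^sub>b \<sigma> s\<^sub>b)\<close>; the functionals are multiplicative on
  \<open>S\<^sub>r \<times> S\<^sub>s \<subseteq> S\<^sub>r\<^sub>+\<^sub>s\<close>; and the supertrace of \<open>M\<^sup>[\<^sup>r\<^sup>]\<close> is \<open>\<tau>\<^sub>r\<close> of the cycle
  \<open>s\<^sub>r\<^sub>-\<^sub>1 \<dots> s\<^sub>1\<close>. Summing the exchange relation over a subgroup that permutes \<open>{r,\<dots>,k}\<close> shows that all cosets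
  which move \<open>r\<close> contribute equally, so that the sum of \<open>\<tau>\<close> over \<open>S\<^sub>k\<close> unravels into products of
  a cycle on the first \<open>r\<close> points and a full sum on the others. The antisymmetric identity is the
  same statement for \<open>\<sigma> \<mapsto> sgn \<sigma> \<tau>(w \<sigma>\<^sup>-\<^sup>1 w)\<close>, where \<open>w\<close> reverses \<open>{1,\<dots>,k}\<close>: it satisfies the
  exchange relation too.
\<close>

section \<open>Sums over the symmetric group under the exchange relation\<close>

text \<open>
  The simplifier would unfold bit arithmetic into case distinctions; below \<^typ>\<open>bit\<close> is used as a field.
\<close>

declare add_bit_eq_xor [simp del] mult_bit_eq_and [simp del]

text \<open>Two obstacles shape the proof. The first is the signs: entries of \<open>M\<close> need
  not commute in any sense, and every graded product drags Koszul signs along. All tensors that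
  matter are even, and for an even right factor the Koszul sign is a coboundary;
  \<open>gauge\<close> absorbs it. Afterwards \<open>Pperm k \<sigma>\<close> is a monomial matrix
  of complex scalars, and all noncommutativity sits in one word, \<open>mprod\<close>.

  The second is the order of the factors. Traces are multiplicative with the first block on the
  left, so a cycle on the first r points yields T(t)S(t), while A(t)T(t) asks for a cycle on the
  last r points. Moreover, a twist by the sign alone yields an exchange relation with left and right
  multiplication interchanged. Passing to inverses repairs this but turns the cycle around;
  conjugating by the reversal turns it back and at the same time carries it to the last r
  points.\<close>

definition adj :: "nat \<Rightarrow> nat \<Rightarrow> nat"
  where "adj i = transpose i (i + 1)"

text \<open>The cycle that sends 1 to \<open>r\<close> and lowers 2, ..., \<open>r\<close> by one
  (see \<open>cyc_apply\<close>). Written in this order it grows by a left factor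
  \<open>adj r\<close>, which is the first transposition met in \<open>coset_sum\<close>.\<close>

definition cyc :: "nat \<Rightarrow> nat \<Rightarrow> nat"
  where "cyc r = foldr (\<lambda>i f. adj i \<circ> f) (rev [1..<r]) id"

lemma adj_permutes: "\<lbrakk>a \<le> i; i < b\<rbrakk> \<Longrightarrow> adj i permutes {a..b}"
  unfolding adj_def by (rule permutes_swap_id) auto

lemma adj_adj [simp]: "adj i \<circ> adj i = id" "adj i \<circ> (adj i \<circ> f) = f"
  by (simp_all add: adj_def fun_eq_iff)

lemma cyc_le_1: "r \<le> 1 \<Longrightarrow> cyc r = id"
  by (simp add: cyc_def)

lemma cyc_Suc: "r \<ge> 1 \<Longrightarrow> cyc (Suc r) = adj r \<circ> cyc r"
  by (simp add: cyc_def)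

lemma cyc_permutes: "\<lbrakk>r \<le> k\<rbrakk> \<Longrightarrow> cyc r permutes {1..k}"
proof (induction r)
  case 0
  then show ?case by (simp only: cyc_le_1 zero_le permutes_id)
next
  case (Suc r)
  show ?case
  proof (cases "r = 0")
    case False
    then show ?thesis
      using Suc by (simp only: cyc_Suc) (intro permutes_compose adj_permutes, auto)
  qed (simp only: cyc_le_1 permutes_id)
qed

lemma cyc_fixes: "r < a \<Longrightarrow> cyc r a = a"
  by (rule permutes_not_in[OF cyc_permutes[of r r]]) auto

lemma transpose_comp_cyc_commute:
  assumes "r < a" "r < b"
  shows "transpose a b \<circ> cyc r = cyc r \<circ> transpose a b"
proof -
  have inj: "inj (cyc r)" using cyc_permutes[of r r] by (simp add: permutes_inj)
  have eq: "cyc r x = a \<longleftrightarrow> x = a" "cyc r x = b \<longleftrightarrow> x = b" for x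
    using cyc_fixes[OF assms(1)] cyc_fixes[OF assms(2)] inj by (metis injD)+
  show ?thesis
    by (auto simp: fun_eq_iff transpose_def eq cyc_fixes assms)
qed

lemma adj_transpose: "\<lbrakk>a < j\<rbrakk> \<Longrightarrow> adj j \<circ> transpose a (Suc j) = transpose a j \<circ> adj j"
  by (auto simp: adj_def fun_eq_iff transpose_def)

lemma permutes_atLeastAtMost_mono: "\<lbrakk>p permutes {a..b::nat}; c \<le> a; b \<le> d\<rbrakk> \<Longrightarrow> p permutes {c..d}"
  by (erule permutes_subset) auto

text \<open>Inverting the summation variable, once over the large group and once over the small one,
  turns the left transposition of \<open>sum_over_permutations_insert\<close> into the right factor
  that \<open>split_sum\<close> calls for.\<close>

lemma sum_permutes_insert_right:
  assumes "finite S" "a \<notin> S"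
  shows "sum f {p. p permutes (insert a S)} =
    (\<Sum>b\<in>insert a S. \<Sum>p | p permutes S. f (p \<circ> transpose a b))"
proof -
  have "sum f {p. p permutes (insert a S)} = (\<Sum>p | p permutes (insert a S). f (inv p))"
    by (rule sum_permutations_inverse)
  also have "\<dots> = (\<Sum>b\<in>insert a S. \<Sum>p | p permutes S. f (inv (transpose a b \<circ> p)))"
    by (rule sum_over_permutations_insert) (use assms in auto)
  also have "\<dots> = (\<Sum>b\<in>insert a S. \<Sum>p | p permutes S. f (inv p \<circ> transpose a b))"
    by (intro sum.cong refl arg_cong[where f = f])
       (simp, subst o_inv_distrib, auto intro: permutes_bij)
  also have "\<dots> = (\<Sum>b\<in>insert a S. \<Sum>p | p permutes S. f (p \<circ> transpose a b))"
    by (rule sum.cong[OF refl],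
        rule sum_permutations_inverse[symmetric, where f = "\<lambda>p. f (p \<circ> transpose a b)" for b])
  finally show ?thesis .
qed

text \<open>The summation argument knows nothing of traces beyond this relation, so it serves both
  series. Summed over a subgroup, the relation gives each side twice; hence
  \<open>double_cancel\<close>, which over complex scalars is division by two.\<close>

locale exchange =
  fixes k :: nat and \<tau> :: "(nat \<Rightarrow> nat) \<Rightarrow> 'a::ring_1"
  assumes double_cancel: "\<And>x y :: 'a. x + x = y + y \<Longrightarrow> x = y"
    and exchange: "\<And>\<sigma> b. \<lbrakk>\<sigma> permutes {1..k}; 1 \<le> b; b < k\<rbrakk> \<Longrightarrow>
      \<tau> \<sigma> + \<tau> (adj b \<circ> \<sigma>) = \<tau> (\<sigma> \<circ> adj b) + \<tau> (adj b \<circ> (\<sigma> \<circ> adj b))"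
begin

text \<open>
  Summing over a subgroup that contains \<open>s\<^sub>b\<close> identifies the two terms on each side of the exchange relation.
\<close>

lemma sum_right_adj:
  assumes "1 \<le> r" "r \<le> b" "b < k" "y permutes {1..k}"
  shows "(\<Sum>\<sigma> | \<sigma> permutes {r..k}. \<tau> (\<sigma> \<circ> y)) = (\<Sum>\<sigma> | \<sigma> permutes {r..k}. \<tau> (\<sigma> \<circ> (y \<circ> adj b)))"
proof (rule double_cancel)
  have left: "(\<Sum>\<sigma> | \<sigma> permutes {r..k}. g (adj b \<circ> \<sigma>)) = sum g {\<sigma>. \<sigma> permutes {r..k}}"
    for g :: "_ \<Rightarrow> 'a"
    by (rule setum_permutations_compose_left[symmetric]) (rule adj_permutes, use assms in auto)
  have "(\<Sum>\<sigma> | \<sigma> permutes {r..k}. \<tau> (\<sigma> \<circ> y)) + (\<Sum>\<sigma> | \<sigma> permutes {r..k}. \<tau> (\<sigma> \<circ> y))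
      = (\<Sum>\<sigma> | \<sigma> permutes {r..k}. \<tau> (\<sigma> \<circ> y) + \<tau> (adj b \<circ> (\<sigma> \<circ> y)))"
    using left[of "\<lambda>\<sigma>. \<tau> (\<sigma> \<circ> y)"] by (simp add: sum.distrib o_assoc)
  also have "\<dots> = (\<Sum>\<sigma> | \<sigma> permutes {r..k}.
      \<tau> (\<sigma> \<circ> (y \<circ> adj b)) + \<tau> (adj b \<circ> (\<sigma> \<circ> (y \<circ> adj b))))"
  proof (rule sum.cong[OF refl])
    fix \<sigma> assume "\<sigma> \<in> {\<sigma>. \<sigma> permutes {r..k}}"
    then have "\<sigma> \<circ> y permutes {1..k}"
      using assms by (auto intro!: permutes_compose intro: permutes_atLeastAtMost_mono)
    then show "\<tau> (\<sigma> \<circ> y) + \<tau> (adj b \<circ> (\<sigma> \<circ> y)) =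
      \<tau> (\<sigma> \<circ> (y \<circ> adj b)) + \<tau> (adj b \<circ> (\<sigma> \<circ> (y \<circ> adj b)))"
      using exchange[of "\<sigma> \<circ> y" b] assms by (simp add: o_assoc)
  qed
  also have "\<dots> = (\<Sum>\<sigma> | \<sigma> permutes {r..k}. \<tau> (\<sigma> \<circ> (y \<circ> adj b)))
      + (\<Sum>\<sigma> | \<sigma> permutes {r..k}. \<tau> (\<sigma> \<circ> (y \<circ> adj b)))"
    using left[of "\<lambda>\<sigma>. \<tau> (\<sigma> \<circ> (y \<circ> adj b))"] by (simp add: sum.distrib o_assoc)
  finally show "(\<Sum>\<sigma> | \<sigma> permutes {r..k}. \<tau> (\<sigma> \<circ> y)) + (\<Sum>\<sigma> | \<sigma> permutes {r..k}. \<tau> (\<sigma> \<circ> y))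
    = (\<Sum>\<sigma> | \<sigma> permutes {r..k}. \<tau> (\<sigma> \<circ> (y \<circ> adj b)))
      + (\<Sum>\<sigma> | \<sigma> permutes {r..k}. \<tau> (\<sigma> \<circ> (y \<circ> adj b)))" .
qed

text \<open>Induction on \<open>j\<close>. A right factor \<open>adj j\<close> is free by
  \<open>sum_right_adj\<close>; it can be pulled through \<open>cyc r\<close> and the transposition,
  which becomes \<open>(r, j)\<close>, and then stands next to \<open>\<sigma>\<close>, where the
  sum over the subgroup absorbs it. At \<open>j = r + 1\<close> the transposition is
  \<open>adj r\<close>, which extends \<open>cyc r\<close> to \<open>cyc (Suc r)\<close>.\<close>

lemma coset_sum:
  assumes "1 \<le> r" "r < j" "j \<le> k"
  shows "(\<Sum>\<sigma> | \<sigma> permutes {Suc r..k}. \<tau> (\<sigma> \<circ> (transpose r j \<circ> cyc r))) =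
         (\<Sum>\<sigma> | \<sigma> permutes {Suc r..k}. \<tau> (\<sigma> \<circ> cyc (Suc r)))"
  using assms(2,3)
proof (induction j)
  case 0
  then show ?case by simp
next
  case (Suc j)
  show ?case
  proof (cases "j = r")
    case True
    then show ?thesis using assms(1) by (simp only: cyc_Suc) (simp add: adj_def)
  next
    case False
    then have j: "r < j" "j < k" using Suc.prems by auto
    let ?H = "{\<sigma>. \<sigma> permutes {Suc r..k}}"
    have "transpose r (Suc j) \<circ> cyc r \<circ> adj j = transpose r (Suc j) \<circ> (adj j \<circ> cyc r)"
      using transpose_comp_cyc_commute[of r j "Suc j"] j by (simp add: adj_def o_assoc)
    also have "\<dots> = adj j \<circ> (transpose r j \<circ> cyc r)"
    proof -
      have "adj j \<circ> transpose r j = transpose r (Suc j) \<circ> adj j"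
        using j by (auto simp: adj_def fun_eq_iff transpose_def)
      then show ?thesis by (simp add: o_assoc)
    qed
    finally have eq: "transpose r (Suc j) \<circ> cyc r \<circ> adj j = adj j \<circ> (transpose r j \<circ> cyc r)" .
    have "(\<Sum>\<sigma>\<in>?H. \<tau> (\<sigma> \<circ> (transpose r (Suc j) \<circ> cyc r)))
        = (\<Sum>\<sigma>\<in>?H. \<tau> (\<sigma> \<circ> (transpose r (Suc j) \<circ> cyc r \<circ> adj j)))"
      by (rule sum_right_adj)
         (use assms j in \<open>auto simp del: One_nat_def intro!: permutes_compose cyc_permutes permutes_swap_id\<close>)
    also have "\<dots> = (\<Sum>\<sigma>\<in>?H. \<tau> ((\<sigma> \<circ> adj j) \<circ> (transpose r j \<circ> cyc r)))"
      unfolding eq by (simp add: o_assoc)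
    also have "\<dots> = (\<Sum>\<sigma>\<in>?H. \<tau> (\<sigma> \<circ> (transpose r j \<circ> cyc r)))"
      by (rule sum_permutations_compose_right[symmetric]) (rule adj_permutes, use j in auto)
    also have "\<dots> = (\<Sum>\<sigma>\<in>?H. \<tau> (\<sigma> \<circ> cyc (Suc r)))"
      by (rule Suc.IH) (use j in auto)
    finally show ?thesis .
  qed
qed

text \<open>Coset decomposition by the permutations of \<open>{Suc r..k}\<close>: the trivial coset,
  and \<open>k - r\<close> others whose sums agree by \<open>coset_sum\<close>.\<close>

lemma split_sum:
  assumes "1 \<le> r" "r \<le> k"
  shows "(\<Sum>\<sigma> | \<sigma> permutes {r..k}. \<tau> (\<sigma> \<circ> cyc r)) =
    (\<Sum>\<sigma> | \<sigma> permutes {Suc r..k}. \<tau> (\<sigma> \<circ> cyc r))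
    + of_nat (k - r) * (\<Sum>\<sigma> | \<sigma> permutes {Suc r..k}. \<tau> (\<sigma> \<circ> cyc (Suc r)))"
proof -
  have ins_notin: "r \<notin> {Suc r..k}" by simp
  have ins: "{r..k} = insert r {Suc r..k}" using assms by auto
  have "(\<Sum>\<sigma> | \<sigma> permutes {r..k}. \<tau> (\<sigma> \<circ> cyc r)) =
    (\<Sum>j\<in>insert r {Suc r..k}. \<Sum>\<sigma> | \<sigma> permutes {Suc r..k}. \<tau> (\<sigma> \<circ> transpose r j \<circ> cyc r))"
    unfolding ins by (rule sum_permutes_insert_right) auto
  also have "\<dots> = (\<Sum>\<sigma> | \<sigma> permutes {Suc r..k}. \<tau> (\<sigma> \<circ> cyc r)) +
     (\<Sum>j\<in>{Suc r..k}. \<Sum>\<sigma> | \<sigma> permutes {Suc r..k}. \<tau> (\<sigma> \<circ> transpose r j \<circ> cyc r))"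
    by (simp only: sum.insert finite_atLeastAtMost ins_notin not_False_eq_True transpose_same comp_id)
  also have "(\<Sum>j\<in>{Suc r..k}. \<Sum>\<sigma> | \<sigma> permutes {Suc r..k}. \<tau> (\<sigma> \<circ> transpose r j \<circ> cyc r))
     = (\<Sum>j\<in>{Suc r..k}. \<Sum>\<sigma> | \<sigma> permutes {Suc r..k}. \<tau> (\<sigma> \<circ> cyc (Suc r)))"
  proof (rule sum.cong[OF refl])
    fix j assume "j \<in> {Suc r..k}"
    then show "(\<Sum>\<sigma> | \<sigma> permutes {Suc r..k}. \<tau> (\<sigma> \<circ> transpose r j \<circ> cyc r))
     = (\<Sum>\<sigma> | \<sigma> permutes {Suc r..k}. \<tau> (\<sigma> \<circ> cyc (Suc r)))"
      using coset_sum[of r j] assms by (simp add: comp_assoc)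
  qed
  finally show ?thesis by (simp only: sum_constant card_atLeastAtMost diff_Suc_Suc)
qed

text \<open>Iteration of \<open>split_sum\<close>: each step leaves the trivial coset behind and
  passes the common value of the others on with multiplicity \<open>k - r\<close>. The weights
  \<open>(k-1)(k-2)...(k-r+1)\<close> are the accumulated multiplicities.\<close>

lemma sum_decomposition:
  "k \<ge> 1 \<Longrightarrow> (\<Sum>\<sigma> | \<sigma> permutes {1..k}. \<tau> \<sigma>) =
    (\<Sum>r\<in>{1..k}. of_nat (\<Prod>i\<in>{1..<r}. k - i) *
       (\<Sum>\<sigma> | \<sigma> permutes {Suc r..k}. \<tau> (\<sigma> \<circ> cyc r)))"
proof -
  assume k: "k \<ge> 1"
  define w :: "nat \<Rightarrow> 'a" where "w r = of_nat (\<Prod>i\<in>{1..<r}. k - i)" for r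
  define E where "E r = (\<Sum>\<sigma> | \<sigma> permutes {Suc r..k}. \<tau> (\<sigma> \<circ> cyc r))" for r
  define F where "F r = (\<Sum>\<sigma> | \<sigma> permutes {r..k}. \<tau> (\<sigma> \<circ> cyc r))" for r
  have w_Suc: "w (Suc r) = w r * of_nat (k - r)" if "r \<ge> 1" for r
    using that by (simp add: w_def prod.atLeastLessThan_Suc)
  have step: "F 1 = (\<Sum>r\<in>{1..s}. w r * E r) + w (Suc s) * F (Suc s)" if "s \<le> k" for s
    using that
  proof (induction s)
    case 0
    then show ?case by (simp add: w_def)
  next
    case (Suc s)
    have F: "F (Suc s) = E (Suc s) + of_nat (k - Suc s) * F (Suc (Suc s))"
      using split_sum[of "Suc s"] Suc.prems unfolding E_def F_def by simp
    have "F 1 = (\<Sum>r\<in>{1..s}. w r * E r) + w (Suc s) * F (Suc s)" using Suc by simp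
    then show ?case unfolding F by (simp add: w_Suc distrib_left mult.assoc)
  qed
  \<comment> \<open>The last multiplicity is \<open>k - k\<close>, so the iteration ends without
    remainder.\<close>
  have "w (Suc k) = 0" using k by (simp add: w_Suc)
  then have "F 1 = (\<Sum>r\<in>{1..k}. w r * E r)" using step[of k] by simp
  then show ?thesis by (simp add: F_def E_def w_def cyc_le_1)
qed

end

lemma prod_diff_mult_fact: "\<lbrakk>1 \<le> r; r \<le> k\<rbrakk> \<Longrightarrow> (\<Prod>i\<in>{1..<r}. k - i) * fact (k - r) = (fact (k - 1) :: nat)"
proof (induction r rule: dec_induct)
  case (step r)
  have "fact (k - r) = (k - r) * (fact (k - Suc r) :: nat)"
    using step by (metis Suc_diff_Suc Suc_le_lessD fact_Suc of_nat_id)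
  then show ?case using step by (simp add: prod.atLeastLessThan_Suc mult.assoc)
qed simp

section \<open>The cocycle of the braid representation\<close>

definition simple_comp :: "nat list \<Rightarrow> nat \<Rightarrow> nat"
  where "simple_comp w = foldr (\<lambda>i f. adj i \<circ> f) w id"

lemma simple_comp_simps [simp]:
  "simple_comp [] = id" "simple_comp (i # w) = adj i \<circ> simple_comp w"
  by (simp_all add: simple_comp_def)

lemma simple_comp_append: "simple_comp (v @ w) = simple_comp v \<circ> simple_comp w"
  by (induction v) (simp_all only: append_Nil append_Cons simple_comp_simps id_comp comp_assoc)

lemma simple_comp_permutes: "set w \<subseteq> {1..<k} \<Longrightarrow> simple_comp w permutes {1..k}"
proof (induction w)
  case Nil
  then show ?case by (simp only: simple_comp_simps permutes_id)
next
  case (Cons i w)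
  then show ?case
    by (simp only: simple_comp_simps) (rule permutes_compose, auto intro: adj_permutes)
qed

lemma transpose_simple_comp:
  "\<lbrakk>1 \<le> a; a < b; b \<le> k\<rbrakk> \<Longrightarrow> \<exists>w. set w \<subseteq> {1..<k} \<and> simple_comp w = transpose a b"
proof (induction b)
  case (Suc b)
  show ?case
  proof (cases "a = b")
    case True
    then show ?thesis using Suc.prems by (intro exI[of _ "[b]"]) (simp add: adj_def)
  next
    case False
    then obtain w where w: "set w \<subseteq> {1..<k}" "simple_comp w = transpose a b"
      using Suc by auto
    have "adj b \<circ> (transpose a b \<circ> adj b) = transpose a (Suc b)"
      using adj_transpose[of a b] False Suc.prems by (metis adj_adj(2) le_less_Suc_eq less_antisym)
    then have "simple_comp (b # w @ [b]) = transpose a (Suc b)"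
      by (simp only: simple_comp_simps simple_comp_append w comp_id)
    moreover have "set (b # w @ [b]) \<subseteq> {1..<k}" using w Suc.prems False by auto
    ultimately show ?thesis by blast
  qed
qed simp

lemma permutes_simple_comp:
  assumes "\<sigma> permutes {1..k}"
  shows "\<exists>w. set w \<subseteq> {1..<k} \<and> simple_comp w = \<sigma>"
  using assms finite_atLeastAtMost
proof (induction \<sigma> rule: permutes_induct)
  case id
  show ?case by (rule exI[of _ "[]"]) simp
next
  case (swap a b p)
  obtain v where v: "set v \<subseteq> {1..<k}" "simple_comp v = transpose a b"
    using transpose_simple_comp[of a b k] transpose_simple_comp[of b a k] swap(1-3)
    by (cases "a < b") (auto simp: transpose_commute)
  obtain w where w: "set w \<subseteq> {1..<k}" "simple_comp w = p" using swap by auto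
  have "simple_comp (v @ w) = transpose a b \<circ> p" by (simp only: simple_comp_append v w)
  then show ?case using v w by (intro exI[of _ "v @ w"]) auto
qed

text \<open>Induction along an arbitrary word, reduced or not: the step may shorten
  \<open>\<sigma>\<close> as well as lengthen it, so a property proved this way has to survive
  both.\<close>

lemma perm_adj_induct [consumes 1, case_names id adj]:
  assumes "\<sigma> permutes {1..k}"
    and "P id"
    and "\<And>i \<sigma>. \<lbrakk>1 \<le> i; i < k; \<sigma> permutes {1..k}; P \<sigma>\<rbrakk> \<Longrightarrow> P (adj i \<circ> \<sigma>)"
  shows "P \<sigma>"
proof -
  obtain w where w: "set w \<subseteq> {1..<k}" "simple_comp w = \<sigma>"
    using permutes_simple_comp[OF assms(1)] by blast
  have "P (simple_comp w)" using w(1)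
  proof (induction w)
    case Nil
    show ?case using assms(2) by (simp only: simple_comp_simps)
  next
    case (Cons i w)
    then show ?case
      by (simp only: simple_comp_simps) (rule assms(3), auto intro: simple_comp_permutes[simplified])
  qed
  then show ?thesis by (simp only: w)
qed

text \<open>The entry at place \<open>a\<close> moves to place \<open>\<sigma> a\<close>; reading
  through \<open>inv \<sigma>\<close> makes this a left action (\<open>pact_comp\<close>).
  Permutations act on \<open>{1..k}\<close> while list positions start at 0, whence the
  offset.\<close>

definition pact :: "(nat \<Rightarrow> nat) \<Rightarrow> 'x list \<Rightarrow> 'x list"
  where "pact \<sigma> J = map (\<lambda>c. J ! (inv \<sigma> c - 1)) [1..<length J + 1]"

lemma permutes_in: "\<lbrakk>\<sigma> permutes S; a \<in> S\<rbrakk> \<Longrightarrow> \<sigma> a \<in> S"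
  by (simp only: permutes_in_image)

lemma length_pact [simp]: "length (pact \<sigma> J) = length J"
  by (simp add: pact_def del: upt_Suc)

lemma pact_nth:
  assumes "\<sigma> permutes {1..length J}" "a \<in> {1..length J}"
  shows "pact \<sigma> J ! (\<sigma> a - 1) = J ! (a - 1)"
proof -
  have "\<sigma> a \<in> {1..length J}" using assms by (rule permutes_in)
  then have "\<sigma> a - 1 < length [1..<length J + 1]" "1 + (\<sigma> a - 1) = \<sigma> a" "\<sigma> a < length J + 1" by auto
  then show ?thesis
    unfolding pact_def using permutes_inverses(2)[OF assms(1)]
    by (simp only: nth_map nth_upt)
qed

lemma pact_eqI:
  assumes "\<sigma> permutes {1..length J}" "length L = length J"
    and "\<And>a. a \<in> {1..length J} \<Longrightarrow> L ! (\<sigma> a - 1) = J ! (a - 1)"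
  shows "pact \<sigma> J = L"
proof (rule nth_equalityI)
  fix c assume "c < length (pact \<sigma> J)"
  then have c: "c + 1 \<in> {1..length J}" by simp
  define a where "a = inv \<sigma> (c + 1)"
  have a: "\<sigma> a = c + 1" using assms(1) by (simp add: a_def permutes_inverses(1))
  then have "a \<in> {1..length J}" using c assms(1) by (metis permutes_in_image)
  then show "pact \<sigma> J ! c = L ! c"
    using pact_nth[OF assms(1), of a] assms(3)[of a] a by simp
qed (simp add: assms)

lemma pact_id [simp]: "pact id J = J"
  by (rule pact_eqI) (simp_all only: permutes_id id_apply)

lemma pact_comp:
  assumes "\<sigma> permutes {1..length J}" "\<tau> permutes {1..length J}"
  shows "pact (\<sigma> \<circ> \<tau>) J = pact \<sigma> (pact \<tau> J)"
proof (rule pact_eqI)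
  show "\<sigma> \<circ> \<tau> permutes {1..length J}" using assms by (intro permutes_compose)
  fix a assume a: "a \<in> {1..length J}"
  then have "\<tau> a \<in> {1..length J}" by (rule permutes_in[OF assms(2)])
  then show "pact \<sigma> (pact \<tau> J) ! ((\<sigma> \<circ> \<tau>) a - 1) = J ! (a - 1)"
    using pact_nth[of \<sigma> "pact \<tau> J" "\<tau> a"] pact_nth[of \<tau> J a] assms a by simp
qed simp

lemma pact_inv_pact:
  assumes "\<sigma> permutes {1..length J}"
  shows "pact (inv \<sigma>) (pact \<sigma> J) = J"
  using assms pact_comp[of "inv \<sigma>" J \<sigma>]
  by (simp only: permutes_inv permutes_inv_o pact_id)

lemma set_pact: "\<sigma> permutes {1..length J} \<Longrightarrow> set (pact \<sigma> J) = set J"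
proof -
  have sub: "set (pact \<sigma> J) \<subseteq> set J" if "\<sigma> permutes {1..length J}" for \<sigma> and J :: "'a list"
  proof
    fix x assume "x \<in> set (pact \<sigma> J)"
    then obtain c where c: "c \<in> {1..length J}" "x = J ! (inv \<sigma> c - 1)"
      by (auto simp: pact_def simp del: upt_Suc One_nat_def) fastforce
    then have "inv \<sigma> c \<in> {1..length J}" using permutes_in[OF permutes_inv[OF that]] by blast
    then show "x \<in> set J" using c by auto
  qed
  assume *: "\<sigma> permutes {1..length J}"
  show ?thesis
    using sub[OF *] sub[of "inv \<sigma>" "pact \<sigma> J"] * by (auto simp: pact_inv_pact permutes_inv)
qed

lemma pact_adj_append: "pact (adj (Suc (length u))) (u @ x # y # v) = u @ y # x # v"
proof (rule pact_eqI)
  show "adj (Suc (length u)) permutes {1..length (u @ x # y # v)}"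
    by (rule adj_permutes) auto
  fix a assume a: "a \<in> {1..length (u @ x # y # v)}"
  consider "a = length u + 1" | "a = length u + 2" | "a \<noteq> length u + 1" "a \<noteq> length u + 2" by blast
  then show "(u @ y # x # v) ! (adj (Suc (length u)) a - 1) = (u @ x # y # v) ! (a - 1)"
  proof cases
    case 3
    then have "adj (Suc (length u)) a = a" by (simp add: adj_def)
    moreover have "a - 1 < length u \<or> a - 1 \<ge> length u + 2" using 3 a by auto
    ultimately show ?thesis by (auto simp: nth_append nth_Cons')
  qed (auto simp: adj_def nth_append)
qed simp

lemma split_at_adj:
  assumes "1 \<le> i" "i < length J"
  obtains u v where "J = u @ J ! (i - 1) # J ! i # v" "i = Suc (length u)"
proof
  have "drop (i - 1) J = J ! (i - 1) # J ! i # drop (i + 1) J"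
    using assms Cons_nth_drop_Suc[of "i - 1" J] Cons_nth_drop_Suc[of i J] by simp
  then show "J = take (i - 1) J @ J ! (i - 1) # J ! i # drop (i + 1) J"
    by (metis append_take_drop_id)
  show "i = Suc (length (take (i - 1) J))" using assms by simp
qed

section \<open>Permutations of a block of places\<close>

definition shift :: "nat \<Rightarrow> (nat \<Rightarrow> nat) \<Rightarrow> nat \<Rightarrow> nat"
  where "shift r \<sigma> = (\<lambda>a. if a \<le> r then a else \<sigma> (a - r) + r)"

lemma shift_id [simp]: "shift r id = id"
  by (auto simp: shift_def fun_eq_iff)

lemma shift_adj_comp:
  assumes "1 \<le> i" "\<sigma> permutes {1..k}"
  shows "shift r (adj i \<circ> \<sigma>) = adj (i + r) \<circ> shift r \<sigma>"
proof
  fix a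
  have "0 < \<sigma> (a - r)" if "r < a"
    using that assms(2) permutes_in_image[OF assms(2), of "a - r"] permutes_not_in[OF assms(2), of "a - r"]
    by (cases "a - r \<in> {1..k}") auto
  then show "shift r (adj i \<circ> \<sigma>) a = (adj (i + r) \<circ> shift r \<sigma>) a"
    using assms(1) by (auto simp: shift_def adj_def transpose_def)
qed

lemma shift_permutes: "\<sigma> permutes {1..k} \<Longrightarrow> shift r \<sigma> permutes {r+1..r+k}"
proof (induction rule: perm_adj_induct)
  case id
  show ?case by (simp only: shift_id permutes_id)
next
  case (adj i \<sigma>)
  then show ?case
    by (simp only: shift_adj_comp) (intro permutes_compose adj_permutes, auto)
qed

lemma pact_shift:
  assumes "\<sigma> permutes {1..length J2}" "length J1 = r"
  shows "pact (shift r \<sigma>) (J1 @ J2) = J1 @ pact \<sigma> J2"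
proof (rule pact_eqI)
  show "shift r \<sigma> permutes {1..length (J1 @ J2)}"
    by (rule permutes_atLeastAtMost_mono[OF shift_permutes[OF assms(1)]]) (use assms in auto)
  fix a assume a: "a \<in> {1..length (J1 @ J2)}"
  show "(J1 @ pact \<sigma> J2) ! (shift r \<sigma> a - 1) = (J1 @ J2) ! (a - 1)"
  proof (cases "a \<le> r")
    case True
    then show ?thesis using a assms by (auto simp: shift_def nth_append)
  next
    case False
    then have "a - r \<in> {1..length J2}" using a assms by auto
    moreover from this have "\<sigma> (a - r) \<in> {1..length J2}" by (rule permutes_in[OF assms(1)])
    ultimately show ?thesis
      using pact_nth[OF assms(1), of "a - r"] False assms(2)
      by (auto simp: shift_def nth_append)
  qed
qed simp

lemma pact_append:
  assumes "\<sigma> permutes {1..length J1}"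
  shows "pact \<sigma> (J1 @ J2) = pact \<sigma> J1 @ J2"
proof (rule pact_eqI)
  show "\<sigma> permutes {1..length (J1 @ J2)}"
    by (rule permutes_atLeastAtMost_mono[OF assms(1)]) auto
  fix a assume a: "a \<in> {1..length (J1 @ J2)}"
  show "(pact \<sigma> J1 @ J2) ! (\<sigma> a - 1) = (J1 @ J2) ! (a - 1)"
  proof (cases "a \<le> length J1")
    case True
    then have "\<sigma> a \<in> {1..length J1}" using a by (intro permutes_in[OF assms]) auto
    then have "\<sigma> a - 1 < length J1" "a - 1 < length J1" using True a by auto
    then show ?thesis
      using pact_nth[OF assms(1), of a] True a by (simp add: nth_append)
  next
    case False
    then have "\<sigma> a = a" by (intro permutes_not_in[OF assms(1)]) auto
    then show ?thesis using False by (auto simp: nth_append)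
  qed
qed simp

definition inversions :: "nat \<Rightarrow> (nat \<Rightarrow> nat) \<Rightarrow> (nat \<times> nat) set"
  where "inversions k \<sigma> = {(a, b). a \<in> {1..k} \<and> b \<in> {1..k} \<and> a < b \<and> \<sigma> b < \<sigma> a}"

lemma finite_inversions [simp]: "finite (inversions k \<sigma>)"
  by (rule finite_subset[of _ "{1..k} \<times> {1..k}"]) (auto simp: inversions_def)

text \<open>\<open>adj i\<close> changes the relative order of two values only if they are
  \<open>i\<close> and \<open>Suc i\<close>; so at an ascent exactly one inversion is
  created.\<close>

lemma inversions_adj:
  assumes "\<sigma> permutes {1..k}" "1 \<le> i" "i < k" "\<sigma> a = i" "\<sigma> b = Suc i" "a < b"
  shows "inversions k (adj i \<circ> \<sigma>) = insert (a, b) (inversions k \<sigma>)" "(a, b) \<notin> inversions k \<sigma>"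
proof -
  have less: "adj i y < adj i x \<longleftrightarrow> (y < x \<and> \<not> (x = Suc i \<and> y = i)) \<or> (x = i \<and> y = Suc i)" for x y
    by (auto simp: adj_def transpose_def)
  have inj: "inj \<sigma>" using assms(1) by (rule permutes_inj)
  have "a \<in> {1..k}" "b \<in> {1..k}"
    using permutes_in_image[OF assms(1), of a] permutes_in_image[OF assms(1), of b] assms by auto
  moreover have "\<sigma> x = i \<longleftrightarrow> x = a" "\<sigma> x = Suc i \<longleftrightarrow> x = b" for x
    using inj assms(4,5) by (metis injD)+
  ultimately show "inversions k (adj i \<circ> \<sigma>) = insert (a, b) (inversions k \<sigma>)"
    using assms(6) by (auto simp: inversions_def less)
  show "(a, b) \<notin> inversions k \<sigma>" using assms by (auto simp: inversions_def)
qed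

text \<open>An abstract flip with commuting scalars. For flips of this monomial form the braid
  relation is automatic, and \<open>p_swap\<close> says that the flip squares to the
  identity.\<close>

locale braiding =
  fixes p :: "'x \<Rightarrow> 'x \<Rightarrow> 'b::comm_monoid_mult"
  assumes p_swap: "p x y * p y x = 1"
begin

text \<open>
  The operators \<open>e\<^sub>J \<mapsto> coc \<sigma> J e\<^sub>\<sigma>\<^sub>J\<close> represent the symmetric group; simple transpositions
  act by \<open>e\<^sub>x \<otimes> e\<^sub>y \<mapsto> p y x e\<^sub>y \<otimes> e\<^sub>x\<close> in adjacent factors.
\<close>

definition coc :: "(nat \<Rightarrow> nat) \<Rightarrow> 'x list \<Rightarrow> 'b"
  where "coc \<sigma> J = (\<Prod>(a, b)\<in>inversions (length J) \<sigma>. p (J ! (b - 1)) (J ! (a - 1)))"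

lemma coc_id [simp]: "coc id J = 1"
proof -
  have "inversions (length J) id = {}" by (auto simp: inversions_def)
  then show ?thesis by (simp add: coc_def)
qed

text \<open>The product over inversions obeys the recursion of an operator word, so every word for
  \<open>\<sigma>\<close> produces the same scalar. An ascent adds one inversion and hence one
  factor; a descent is an ascent read backwards, with the factor inverted by
  \<open>p_swap\<close>.\<close>

lemma coc_adj_comp:
  assumes "\<sigma> permutes {1..length J}" "1 \<le> i" "i < length J"
  shows "coc (adj i \<circ> \<sigma>) J = p (pact \<sigma> J ! i) (pact \<sigma> J ! (i - 1)) * coc \<sigma> J"
proof -
  have asc: "coc (adj i \<circ> \<sigma>) J = p (pact \<sigma> J ! i) (pact \<sigma> J ! (i - 1)) * coc \<sigma> J"
    if *: "\<sigma> permutes {1..length J}" "\<sigma> a = i" "\<sigma> b = Suc i" "a < b" for \<sigma> a b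
  proof -
    have "a \<in> {1..length J}" "b \<in> {1..length J}"
      using permutes_in_image[OF *(1), of a] permutes_in_image[OF *(1), of b] * assms by auto
    then have "pact \<sigma> J ! (i - 1) = J ! (a - 1)" "pact \<sigma> J ! i = J ! (b - 1)"
      using pact_nth[OF *(1), of a] pact_nth[OF *(1), of b] * by auto
    then show ?thesis
      unfolding coc_def inversions_adj(1)[OF *(1) assms(2,3) *(2-4)]
      using inversions_adj(2)[OF *(1) assms(2,3) *(2-4)] by simp
  qed
  obtain a b where ab: "\<sigma> a = i" "\<sigma> b = Suc i"
    using permutes_surj[OF assms(1)] by (metis surjD)
  then have "a \<noteq> b" by auto
  then consider "a < b" | "b < a" by linarith
  then show ?thesis
  proof cases
    case 1
    then show ?thesis using asc assms ab by blast
  next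
    case 2
    have adjp: "adj i permutes {1..length J}" by (rule adj_permutes) (use assms in auto)
    then have perm: "adj i \<circ> \<sigma> permutes {1..length J}"
      using assms(1) by (intro permutes_compose)
    have "coc (adj i \<circ> (adj i \<circ> \<sigma>)) J
        = p (pact (adj i \<circ> \<sigma>) J ! i) (pact (adj i \<circ> \<sigma>) J ! (i - 1)) * coc (adj i \<circ> \<sigma>) J"
      by (rule asc[of _ b a]) (use perm ab 2 in \<open>auto simp: adj_def\<close>)
    moreover have "pact (adj i \<circ> \<sigma>) J ! i = pact \<sigma> J ! (i - 1)" "pact (adj i \<circ> \<sigma>) J ! (i - 1) = pact \<sigma> J ! i"
      unfolding pact_comp[OF adjp assms(1)]
      using pact_nth[of "adj i" "pact \<sigma> J" i] pact_nth[of "adj i" "pact \<sigma> J" "Suc i"] adjp assms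
      by (auto simp: adj_def)
    ultimately have "coc \<sigma> J = p (pact \<sigma> J ! (i - 1)) (pact \<sigma> J ! i) * coc (adj i \<circ> \<sigma>) J"
      by (simp only: adj_adj)
    then have "p (pact \<sigma> J ! i) (pact \<sigma> J ! (i - 1)) * coc \<sigma> J
      = (p (pact \<sigma> J ! i) (pact \<sigma> J ! (i - 1)) * p (pact \<sigma> J ! (i - 1)) (pact \<sigma> J ! i)) * coc (adj i \<circ> \<sigma>) J"
      by (simp only: mult.assoc)
    then show ?thesis by (simp only: p_swap mult_1_left)
  qed
qed

lemma coc_adj: "\<lbrakk>1 \<le> i; i < length J\<rbrakk> \<Longrightarrow> coc (adj i) J = p (J ! i) (J ! (i - 1))"
  using coc_adj_comp[of id J i] by (simp only: permutes_id pact_id coc_id comp_id mult_1_right)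

text \<open>The cocycle law: the monomial operators compose as the permutations do. Simple
  transpositions are peeled off the left factor.\<close>

lemma coc_comp:
  assumes "\<sigma> permutes {1..length J}" "\<tau> permutes {1..length J}"
  shows "coc (\<sigma> \<circ> \<tau>) J = coc \<sigma> (pact \<tau> J) * coc \<tau> J"
  using assms(1)
proof (induction \<sigma> rule: perm_adj_induct)
  case id
  show ?case by (simp only: id_comp coc_id mult_1_left)
next
  case (adj i \<sigma>)
  have "\<sigma> \<circ> \<tau> permutes {1..length J}" using adj assms by (intro permutes_compose)
  then show ?case
    using adj assms
    by (simp only: comp_assoc coc_adj_comp length_pact pact_comp mult.assoc)
qed

lemma coc_shift:
  assumes "\<sigma> permutes {1..length J2}" "length J1 = r"
  shows "coc (shift r \<sigma>) (J1 @ J2) = coc \<sigma> J2"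
  using assms(1)
proof (induction \<sigma> rule: perm_adj_induct)
  case id
  show ?case by (simp only: shift_id coc_id)
next
  case (adj i \<sigma>)
  have "coc (shift r (adj i \<circ> \<sigma>)) (J1 @ J2) = coc (adj (i + r) \<circ> shift r \<sigma>) (J1 @ J2)"
    by (simp only: shift_adj_comp[OF adj(1,3)])
  also have "\<dots> = p ((J1 @ pact \<sigma> J2) ! (i + r)) ((J1 @ pact \<sigma> J2) ! (i + r - 1)) * coc (shift r \<sigma>) (J1 @ J2)"
  proof -
    have "shift r \<sigma> permutes {1..length (J1 @ J2)}"
      by (rule permutes_atLeastAtMost_mono[OF shift_permutes[OF adj(3)]]) (use assms in auto)
    then show ?thesis
      using adj assms(2) by (subst coc_adj_comp) (auto simp only: pact_shift, auto)
  qed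
  also have "\<dots> = p (pact \<sigma> J2 ! i) (pact \<sigma> J2 ! (i - 1)) * coc \<sigma> J2"
    using adj assms(2) by (auto simp: nth_append)
  also have "\<dots> = coc (adj i \<circ> \<sigma>) J2"
    using adj by (simp only: coc_adj_comp)
  finally show ?case .
qed

lemma coc_append:
  assumes "\<sigma> permutes {1..length J1}"
  shows "coc \<sigma> (J1 @ J2) = coc \<sigma> J1"
  using assms
proof (induction \<sigma> rule: perm_adj_induct)
  case id
  show ?case by (simp only: coc_id)
next
  case (adj i \<sigma>)
  have "\<sigma> permutes {1..length (J1 @ J2)}"
    by (rule permutes_atLeastAtMost_mono[OF adj(3)]) auto
  then have "coc (adj i \<circ> \<sigma>) (J1 @ J2)
    = p ((pact \<sigma> J1 @ J2) ! i) ((pact \<sigma> J1 @ J2) ! (i - 1)) * coc \<sigma> (J1 @ J2)"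
    using adj by (subst coc_adj_comp) (auto simp only: pact_append, auto)
  also have "\<dots> = p (pact \<sigma> J1 ! i) (pact \<sigma> J1 ! (i - 1)) * coc \<sigma> J1"
    using adj by (auto simp: nth_append)
  also have "\<dots> = coc (adj i \<circ> \<sigma>) J1"
    using adj by (simp only: coc_adj_comp)
  finally show ?case .
qed

text \<open>The cycle carries \<open>j\<close> to the right past \<open>I\<close>, one neighbour
  \<open>x\<close> at a time, and each crossing costs \<open>p x j\<close>. The tail
  \<open>K\<close> is arbitrary because the induction hypothesis is used with the last entry of
  \<open>I\<close> moved into it.\<close>

lemma cyc_act:
  "pact (cyc (Suc (length I))) (j # I @ K) = I @ j # K \<and>
   coc (cyc (Suc (length I))) (j # I @ K) = prod_list (map (\<lambda>x. p x j) I)"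
proof (induction I arbitrary: K rule: rev_induct)
  case Nil
  show ?case by (simp only: cyc_le_1 le_refl list.size One_nat_def pact_id coc_id append_Nil list.map prod_list.Nil)
next
  case (snoc x I)
  let ?r = "Suc (length I)" and ?J = "j # I @ x # K"
  have IH: "pact (cyc ?r) ?J = I @ j # x # K" "coc (cyc ?r) ?J = prod_list (map (\<lambda>x. p x j) I)"
    using snoc[of "x # K"] by auto
  have c: "cyc ?r permutes {1..length ?J}" by (rule cyc_permutes) simp
  have a: "adj ?r permutes {1..length ?J}" by (rule adj_permutes) auto
  have s: "cyc (Suc (length (I @ [x]))) = adj ?r \<circ> cyc ?r"
    using cyc_Suc[of ?r] by simp
  have "pact (adj ?r \<circ> cyc ?r) ?J = I @ x # j # K"
    by (simp only: pact_comp[OF a c] IH pact_adj_append)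
  moreover have "coc (adj ?r \<circ> cyc ?r) ?J = p x j * prod_list (map (\<lambda>x. p x j) I)"
    using c by (subst coc_adj_comp) (auto simp: IH nth_append)
  ultimately show ?case
    by (simp only: s append_assoc append_Cons append_Nil map_append list.map prod_list.append
        prod_list.Cons prod_list.Nil mult_1_left mult_1_right mult.commute simp_thms)
qed

end

section \<open>Removing the signs of the graded tensor product\<close>

lemma bit_char_2 [simp]: "b + b = (0 :: bit)" "b + (b + c) = (c :: bit)"
  by (cases b; cases c; simp)+

lemma ksgn_simps [simp]: "ksgn 0 = 1" "ksgn b * ksgn b = (1 :: 'a::ring_1)"
  "ksgn b * (ksgn b * x) = (x :: 'a::ring_1)"
  by (auto simp: ksgn_def)

lemma ksgn_left_commute: "ksgn a * (ksgn b * x) = (ksgn b * (ksgn a * x) :: 'a::ring_1)"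
  by (simp add: ksgn_def)

lemma ksgn_add: "ksgn (b + c) = (ksgn b * ksgn c :: 'a::ring_1)"
  by (cases b; cases c) (simp_all add: ksgn_def)

lemma sum_fun_apply: "(\<Sum>x\<in>S. f x) y = (\<Sum>x\<in>S. f x y)"
  by (induction S rule: infinite_finite_induct) simp_all

context q_super
begin

definition lpar :: "nat list \<Rightarrow> bit"
  where "lpar I = sum_list (map par I)"

lemma lpar_simps [simp]:
  "lpar [] = 0" "lpar (i # I) = par i + lpar I" "lpar (I @ J) = lpar I + lpar J"
  by (simp_all add: lpar_def)

lemma lpar_pact:
  "\<sigma> permutes {1..length J} \<Longrightarrow> lpar (pact \<sigma> J) = lpar J"
proof (induction \<sigma> rule: perm_adj_induct)
  case id
  show ?case by (simp only: pact_id)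
next
  case (adj i \<sigma>)
  obtain u x y v where uv: "pact \<sigma> J = u @ x # y # v" "i = Suc (length u)"
    using split_at_adj[of i "pact \<sigma> J"] adj by (metis length_pact)
  have "adj i permutes {1..length J}" by (rule adj_permutes) (use adj in auto)
  then have eq: "pact (adj i \<circ> \<sigma>) J = u @ y # x # v"
    using adj pact_adj_append[of u x y v] by (simp only: pact_comp uv)
  show ?case using adj.IH unfolding eq by (simp add: uv add.left_commute)
qed

text \<open>
  Multiplying the coefficient at \<open>I, J\<close> by \<open>(-1)\<close> to the power \<open>gexp I J\<close> turns the graded product
  with an even right factor into the plain product of matrices indexed by \<open>indices k\<close>.
\<close>

fun gexp :: "nat list \<Rightarrow> nat list \<Rightarrow> bit"
  where
    "gexp (i # I) (j # J) = (par i + par j) * (par j + lpar J) + gexp I J"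
  | "gexp _ _ = 0"

lemma gexp_same [simp]: "gexp I I = 0"
  by (induction I) auto

lemma gexp_append: "length I = length J \<Longrightarrow>
  gexp (I @ K) (J @ L) = gexp I J + (lpar I + lpar J) * lpar L + gexp K L"
  by (induction I J rule: list_induct2) (simp_all add: algebra_simps)

text \<open>The left side is the whole Koszul exponent of a product with even right factor:
  \<open>lpar K + lpar J\<close> is the parity of the coefficient that passes the left matrix units,
  and the double sum is unit past unit. The right side is a coboundary, which is why a rescaling of
  coefficients can remove the sign.\<close>

lemma sign_exponent:
  assumes "length I = length K" "length K = length J"
  shows "(\<Sum>p<length I. par (I ! p) + par (K ! p)) * (lpar K + lpar J)
      + (\<Sum>p<length I. \<Sum>r<p. (par (I ! p) + par (K ! p)) * (par (K ! r) + par (J ! r)))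
      = gexp I K + gexp K J + gexp I J"
proof -
  have lin: "(\<Sum>p<length I. par (I ! p) + par (K ! p)) = lpar I + lpar K"
    if "length I = length K" for I K
    using that by (induction I K rule: list_induct2) (simp_all add: sum.lessThan_Suc_shift algebra_simps del: sum.lessThan_Suc)
  have "(lpar I + lpar K) * (lpar K + lpar J)
      + (\<Sum>p<length I. \<Sum>r<p. (par (I ! p) + par (K ! p)) * (par (K ! r) + par (J ! r)))
      = gexp I K + gexp K J + gexp I J"
    using assms
  proof (induction I K J rule: list_induct3)
    case (Cons i I k K j J)
    let ?D = "\<Sum>p<length I. \<Sum>r<p. (par (I ! p) + par (K ! p)) * (par (K ! r) + par (J ! r))"
    have D: "(\<Sum>p<length (i # I). \<Sum>r<p. (par ((i # I) ! p) + par ((k # K) ! p)) * (par ((k # K) ! r) + par ((j # J) ! r)))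
       = (lpar I + lpar K) * (par k + par j) + ?D"
      using lin[of I K] Cons.hyps
      by (simp add: sum.lessThan_Suc_shift sum.distrib sum_distrib_right[symmetric] del: sum.lessThan_Suc)
    \<comment> \<open>A polynomial identity over the two-element field, checked on all values:
      \<open>i'\<close>, \<open>k'\<close>, \<open>j'\<close> are the parities of the heads,
      \<open>a\<close>, \<open>b\<close>, \<open>c\<close> those of the tails, and \<open>d\<close>
      is the double sum over the tails.\<close>
    have key: "(i' + a + (k' + b)) * (k' + b + (j' + c)) + ((a + b) * (k' + j') + d)
       = (i' + k') * (k' + b) + (k' + j') * (j' + c) + (i' + j') * (j' + c) + ((a + b) * (b + c) + d)"
      for i' k' j' a b c d :: bit
      by (cases i'; cases k'; cases j'; cases a; cases b; cases c; simp)
    show ?case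
      unfolding D lpar_simps key gexp.simps Cons.IH by (simp only: ac_simps)
  qed simp
  then show ?thesis by (simp only: lin[OF assms(1)])
qed

lemma indices_0 [simp]: "indices 0 = {[]}"
  by (auto simp: indices_def)

lemma indices_Suc: "indices (Suc k) = (\<lambda>(i, I). i # I) ` ({1..m + n} \<times> indices k)"
  by (auto simp: indices_def length_Suc_conv image_iff)

lemma Cons_in_indices [simp]: "i # I \<in> indices (Suc k) \<longleftrightarrow> i \<in> {1..m + n} \<and> I \<in> indices k"
  by (auto simp: indices_def)

lemma length_indices: "I \<in> indices k \<Longrightarrow> length I = k"
  by (simp add: indices_def)

lemma finite_indices [simp]: "finite (indices k)"
  by (induction k) (simp_all add: indices_Suc)

lemma sum_indices_Suc: "(\<Sum>I\<in>indices (Suc k). f I) = (\<Sum>i\<in>{1..m + n}. \<Sum>I\<in>indices k. f (i # I))"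
  unfolding indices_Suc
  by (subst sum.reindex) (auto simp: inj_on_def sum.cartesian_product intro!: sum.cong)

lemma sum_indices_add: "(\<Sum>I\<in>indices (r + s). f I) = (\<Sum>I\<in>indices r. \<Sum>J\<in>indices s. f (I @ J))"
  by (induction r arbitrary: f) (simp_all add: sum_indices_Suc)

lemma sum_indices_snoc: "(\<Sum>I\<in>indices (Suc k). f I) = (\<Sum>I\<in>indices k. \<Sum>i\<in>{1..m + n}. f (I @ [i]))"
  using sum_indices_add[of f k 1] by (simp add: sum_indices_Suc)

lemma pact_in_indices:
  "\<lbrakk>\<sigma> permutes {1..k}; J \<in> indices k\<rbrakk> \<Longrightarrow> pact \<sigma> J \<in> indices k"
  by (simp add: indices_def set_pact)

lemma sum_indices_pact:
  assumes "\<sigma> permutes {1..k}"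
  shows "(\<Sum>J\<in>indices k. f (pact \<sigma> J)) = (\<Sum>J\<in>indices k. f J)"
proof (rule sum.reindex_bij_witness[of _ "pact (inv \<sigma>)" "pact \<sigma>"])
  fix J assume J: "J \<in> indices k"
  then show "pact (inv \<sigma>) (pact \<sigma> J) = J" using assms pact_inv_pact[of \<sigma> J] by (simp add: length_indices)
  show "pact \<sigma> (pact (inv \<sigma>) J) = J"
    using pact_inv_pact[of "inv \<sigma>" J] permutes_inv[OF assms] permutes_inv_inv[OF assms]
    by (simp only: length_indices[OF J])
qed (use assms in \<open>auto simp del: One_nat_def intro: pact_in_indices permutes_inv\<close>)

definition tcoef :: "(nat \<Rightarrow> nat \<Rightarrow> complex) list \<Rightarrow> nat list \<Rightarrow> nat list \<Rightarrow> complex"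
  where "tcoef as I J = (\<Prod>p<length as. (as ! p) (I ! p) (J ! p))"

lemma tcoef_simps [simp]:
  "tcoef [] I J = 1" "tcoef (a # as) (i # I) (j # J) = a i j * tcoef as I J"
  by (simp_all add: tcoef_def prod.lessThan_Suc_shift del: prod.lessThan_Suc)

lemma tcoef_append:
  "\<lbrakk>length as = length I; length I = length J\<rbrakk> \<Longrightarrow>
    tcoef (as @ bs) (I @ K) (J @ L) = tcoef as I J * tcoef bs K L"
  by (induction as I J rule: list_induct3) simp_all

lemma ptens_tcoef:
  "\<lbrakk>length I = length as; length J = length as\<rbrakk> \<Longrightarrow> ptens x as I J = scale (tcoef as I J) x"
  by (simp add: ptens_def tcoef_def)

lemma mid_apply: "mid i j = (if i = j \<and> i \<in> {1..m + n} then 1 else 0)"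
proof -
  have "mid i j = (\<Sum>x\<in>{1..m + n}. if i = x then (if i = j then 1 else 0) else 0)"
    unfolding mid_def sum_fun_apply munit_def by (rule sum.cong) auto
  then show ?thesis by simp
qed

lemma tcoef_mid:
  "\<lbrakk>I \<in> indices k; length J = k\<rbrakk> \<Longrightarrow> tcoef (replicate k mid) I J = (if I = J then 1 else 0)"
proof (induction k arbitrary: I J)
  case (Suc k)
  then obtain i I' j J' where "I = i # I'" "J = j # J'"
    by (metis length_Suc_conv length_indices)
  then show ?case using Suc by (auto simp: mid_apply)
qed simp

definition gauge :: "'r tensor \<Rightarrow> 'r tensor"
  where "gauge X I J = scale (ksgn (gexp I J)) (X I J)"

lemma scale_ksgn: "ksgn b * x = scale (ksgn b) x"
  by (simp add: ksgn_def)

lemma scale_in_grade: "x \<in> grade b \<Longrightarrow> scale c x \<in> grade b"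
  using subspace_grade by (rule subspace_scale)

text \<open>The description in \<open>hcomp\<close> is proper because two candidates differ by an
  element of \<open>grade 0\<close> and \<open>grade 1\<close> at once.\<close>

lemma hcomp_grade:
  assumes "y \<in> grade c"
  shows "hcomp b y = (if b = c then y else 0)"
proof -
  have uniq: "u = v" if "u \<in> grade b" "y - u \<in> grade (b + 1)" "v \<in> grade b" "y - v \<in> grade (b + 1)" for u v b
  proof -
    have "(y - v) - (y - u) \<in> grade (b + 1)" "u - v \<in> grade b"
      using that subspace_grade by (blast intro: subspace_diff)+
    then have "u - v \<in> grade 0 \<inter> grade 1" by (cases b) auto
    then show "u = v" using grade_inter by auto
  qed
  have "(if b = c then y else 0) \<in> grade b \<and> y - (if b = c then y else 0) \<in> grade (b + 1)"
  proof (cases "b = c")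
    case False
    then have "b + 1 = c" by (cases b; cases c) auto
    then show ?thesis using assms False subspace_grade subspace_0 by auto
  qed (use assms subspace_grade subspace_0 in auto)
  then show ?thesis
    unfolding hcomp_def using uniq by (intro the_equality) blast+
qed

text \<open>Evenness of the element as a whole: each coefficient has the parity of its matrix unit,
  so Koszul signs can be read off the indices.\<close>

definition even_tensor :: "nat \<Rightarrow> 'r tensor \<Rightarrow> bool"
  where "even_tensor k X \<longleftrightarrow> (\<forall>I\<in>indices k. \<forall>J\<in>indices k. X I J \<in> grade (lpar I + lpar J))"

lemma ungauge: "X I J = scale (ksgn (gexp I J)) (gauge X I J)"
  by (simp add: gauge_def)

text \<open>Only coefficients of the right factor move past matrix units, so evenness is asked of
  \<open>Y\<close>. Then \<open>hcomp\<close> keeps a single parity, and the three terms of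
  \<open>sign_exponent\<close> are shared out among the three gauged coefficients.\<close>

lemma gauge_tmul:
  assumes "even_tensor k Y" "I \<in> indices k" "J \<in> indices k"
  shows "gauge (X \<star> Y) I J = (\<Sum>K\<in>indices k. gauge X I K * gauge Y K J)"
proof -
  have len: "length I = k" "length J = k" using assms length_indices by auto
  have "(X \<star> Y) I J = (\<Sum>K\<in>indices k.
     scale (ksgn (gexp I K + gexp K J + gexp I J)) (X I K * Y K J))"
    unfolding tmul_def len
  proof (simp only: if_True len refl, rule sum.cong[OF refl])
    fix K assume K: "K \<in> indices k"
    then have "Y K J \<in> grade (lpar K + lpar J)" using assms by (simp add: even_tensor_def)
    note h = hcomp_grade[OF this]
    have e: "(\<Sum>p<k. par (I ! p) + par (K ! p)) * (lpar K + lpar J) +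
      (\<Sum>p<k. \<Sum>r<p. (par (I ! p) + par (K ! p)) * (par (K ! r) + par (J ! r)))
      = gexp I K + gexp K J + gexp I J"
      using sign_exponent[of I K J] K len by (simp add: length_indices)
    have "(\<Sum>b\<in>{0, 1}. ksgn ((\<Sum>p<k. par (I ! p) + par (K ! p)) * b +
           (\<Sum>p<k. \<Sum>r<p. (par (I ! p) + par (K ! p)) * (par (K ! r) + par (J ! r)))) *
           (X I K * hcomp b (Y K J)))
      = ksgn ((\<Sum>p<k. par (I ! p) + par (K ! p)) * (lpar K + lpar J) +
      (\<Sum>p<k. \<Sum>r<p. (par (I ! p) + par (K ! p)) * (par (K ! r) + par (J ! r)))) * (X I K * Y K J)"
      unfolding h by (cases "lpar K + lpar J") simp_all
    then show "(\<Sum>b\<in>{0, 1}. ksgn ((\<Sum>p<k. par (I ! p) + par (K ! p)) * b +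
           (\<Sum>p<k. \<Sum>r<p. (par (I ! p) + par (K ! p)) * (par (K ! r) + par (J ! r)))) *
           (X I K * hcomp b (Y K J))) = scale (ksgn (gexp I K + gexp K J + gexp I J)) (X I K * Y K J)"
      unfolding e by (simp only: scale_ksgn)
  qed
  moreover have "ksgn e * ksgn (a + b + e) = (ksgn a * ksgn b :: complex)" for a b e
    by (cases a; cases b; cases e) (simp_all add: ksgn_def)
  ultimately show ?thesis
    by (simp add: gauge_def scale_sum_right scale_mult_left[symmetric] scale_mult_right[symmetric] mult.commute)
qed

lemma gauge_even: "\<lbrakk>even_tensor k X; I \<in> indices k; J \<in> indices k\<rbrakk> \<Longrightarrow> gauge X I J \<in> grade (lpar I + lpar J)"
  by (simp add: gauge_def even_tensor_def scale_in_grade)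

lemma even_tensorI: "(\<And>I J. \<lbrakk>I \<in> indices k; J \<in> indices k\<rbrakk> \<Longrightarrow> gauge X I J \<in> grade (lpar I + lpar J))
  \<Longrightarrow> even_tensor k X"
  unfolding even_tensor_def by (metis ungauge scale_in_grade)

lemma even_tmul:
  assumes "even_tensor k X" "even_tensor k Y"
  shows "even_tensor k (X \<star> Y)"
proof (rule even_tensorI)
  fix I J assume IJ: "I \<in> indices k" "J \<in> indices k"
  have "gauge X I K * gauge Y K J \<in> grade (lpar I + lpar J)" if "K \<in> indices k" for K
  proof -
    have "gauge X I K * gauge Y K J \<in> grade ((lpar I + lpar K) + (lpar K + lpar J))"
      using that IJ assms by (intro mult_in_grade gauge_even)
    then show ?thesis by (simp add: add.assoc)
  qed
  then show "gauge (X \<star> Y) I J \<in> grade (lpar I + lpar J)"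
    unfolding gauge_tmul[OF assms(2) IJ] by (intro subspace_sum subspace_grade)
qed

lemma gauge_tone:
  "\<lbrakk>I \<in> indices k; J \<in> indices k\<rbrakk> \<Longrightarrow> gauge (tone k) I J = (if I = J then 1 else 0)"
  by (auto simp: gauge_def tone_def ptens_tcoef length_indices tcoef_mid)

lemma even_tone: "even_tensor k (tone k)"
  by (rule even_tensorI) (auto simp: gauge_tone one_in_grade subspace_0 subspace_grade)

text \<open>The scalar of the gauged \<open>Pq\<close>: the gauge replaces the sign
  \<open>(-1)^j\<close> of its definition by the symmetric \<open>(-1)^(ij)\<close>, see
  \<open>gauge_Pq\<close>.\<close>

definition pcoef :: "nat \<Rightarrow> nat \<Rightarrow> complex"
  where "pcoef x y = q powi sgn (int x - int y) * ksgn (par x * par y)"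

lemma pcoef_swap: "pcoef x y * pcoef y x = 1"
proof -
  have "q powi sgn (int x - int y) * q powi sgn (int y - int x) = 1"
    using q_nonzero by (auto simp: sgn_if power_int_minus)
  moreover have "ksgn (par x * par y) * ksgn (par y * par x) = (1 :: complex)"
    by (simp add: mult.commute[of "par x"])
  moreover have "pcoef x y * pcoef y x = (q powi sgn (int x - int y) * q powi sgn (int y - int x)) *
      (ksgn (par x * par y) * ksgn (par y * par x))"
    unfolding pcoef_def by (simp only: mult.assoc mult.left_commute)
  ultimately show ?thesis by (simp only: mult_1_right)
qed

end

sublocale q_super \<subseteq> braiding "pcoef :: nat \<Rightarrow> nat \<Rightarrow> complex"
  by unfold_locales (rule pcoef_swap)

lemma sum_delta_mult:
  fixes c :: "'a::semiring_0"
  shows "\<lbrakk>finite S; a \<in> S\<rbrakk> \<Longrightarrow> (\<Sum>x\<in>S. (if x = a then c else 0) * g x) = c * g a"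
  using sum.delta[of S a "\<lambda>x. c * g x"] by (simp add: if_distrib[of "\<lambda>y. y * _"] cong: if_cong)

lemma sum_delta_delta:
  assumes "finite S" "a \<in> S" "b \<in> S"
  shows "(\<Sum>i\<in>S. \<Sum>j\<in>S. if i = a then if j = b then f i j else 0 else 0) = f a b"
proof -
  have "(\<Sum>j\<in>S. if i = a then if j = b then f i j else 0 else 0) = (if i = a then f i b else 0)" for i
    using assms by (simp add: sum.delta)
  then show ?thesis using assms by (simp add: sum.delta)
qed

lemma sum_triple_delta:
  assumes "finite S" "finite T" "finite U" "a \<in> S" "b \<in> T" "c \<in> U"
  shows "(\<Sum>x\<in>S. \<Sum>y\<in>T. \<Sum>z\<in>U. if x = a then if y = b then if z = c then d else 0 else 0 else 0) = d"
proof -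
  have "(\<Sum>z\<in>U. if x = a then if y = b then if z = c then d else 0 else 0 else 0)
      = (if x = a then if y = b then d else 0 else 0)" for x y
    using assms by (simp add: sum.delta)
  moreover have "(\<Sum>y\<in>T. if x = a then if y = b then d else 0 else 0) = (if x = a then d else 0)" for x
    using assms by (simp add: sum.delta)
  ultimately show ?thesis using assms by (simp add: sum.delta)
qed

lemma pact_adj_nth:
  assumes "1 \<le> i" "i < length J"
  shows "pact (adj i) J ! i = J ! (i - 1)" "pact (adj i) J ! (i - 1) = J ! i"
proof -
  have "adj i permutes {1..length J}" by (rule adj_permutes) (use assms in auto)
  then show "pact (adj i) J ! i = J ! (i - 1)" "pact (adj i) J ! (i - 1) = J ! i"
    using assms pact_nth[of "adj i" J i] pact_nth[of "adj i" J "i + 1"] by (auto simp: adj_def)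
qed

lemma pact_adj_adj:
  assumes "1 \<le> i" "i < length J"
  shows "pact (adj i) (pact (adj i) J) = J"
proof -
  have "adj i permutes {1..length J}" by (rule adj_permutes) (use assms in auto)
  then show ?thesis using pact_comp[of "adj i" J "adj i"] by (simp only: adj_adj pact_id)
qed

lemma split_length:
  assumes "length J = r + Suc s"
  obtains u j v where "J = u @ j # v" "length u = r" "length v = s"
  using assms by (metis append_take_drop_id add_diff_cancel_left' length_Suc_conv length_drop length_take min.absorb2 le_add1)

context q_super
begin

section \<open>Gauged coefficients of P^q and of M_1 ... M_k\<close>

lemma scale_one_mult [simp]: "scale c 1 * x = scale c x" "x * scale c 1 = scale c x"
  by (simp_all add: scale_mult_left[symmetric] scale_mult_right[symmetric])

lemma Pq_apply:
  assumes "length u = length u'" "length v = length v'"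
    and "u @ x # y # v \<in> indices k" "u' @ x' # y' # v' \<in> indices k"
  shows "Pq k (Suc (length u)) (u @ x # y # v) (u' @ x' # y' # v')
    = (if u = u' \<and> v = v' \<and> x' = y \<and> y' = x
       then scale (q powi sgn (int x - int y) * ksgn (par y)) 1 else 0)"
proof -
  have k: "k = Suc (Suc (length u + length v))" and u: "u \<in> indices (length u)" and v: "v \<in> indices (length v)"
    and xy: "x \<in> {1..m + n}" "y \<in> {1..m + n}"
    using assms(3) by (auto simp: indices_def)
  let ?d = "if u = u' \<and> v = v' \<and> x' = y \<and> y' = x then 1 else 0 :: complex"
  have t: "ptens 1 (replicate (length u) mid @ [munit i j, munit j i] @ replicate (length v) mid)
      (u @ x # y # v) (u' @ x' # y' # v')
    = (if i = x then if j = y then scale ?d 1 else 0 else 0)" for i j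
    using assms(1,2) u v by (auto simp: ptens_tcoef tcoef_append tcoef_mid munit_def)
  have "Pq k (Suc (length u)) (u @ x # y # v) (u' @ x' # y' # v')
    = (\<Sum>i\<in>{1..m + n}. \<Sum>j\<in>{1..m + n}. if i = x then if j = y then
         scale (q powi sgn (int i - int j) * ksgn (par j)) (scale ?d 1) else 0 else 0)"
    unfolding Pq_def sum_fun_apply tscale_def k
    by (intro sum.cong refl) (simp add: t[simplified] del: scale_scale)
  also have "\<dots> = scale (q powi sgn (int x - int y) * ksgn (par y)) (scale ?d 1)"
    using xy by (intro sum_delta_delta) auto
  finally show ?thesis by simp
qed

lemma gauge_Pq:
  assumes "I \<in> indices k" "J \<in> indices k" "1 \<le> i" "i < k"
  shows "gauge (Pq k i) I J = (if J = pact (adj i) I then scale (pcoef (I ! (i - 1)) (I ! i)) 1 else 0)"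
proof -
  have len: "length I = k" "length J = k" using assms length_indices by auto
  obtain u v where I: "I = u @ I ! (i - 1) # I ! i # v" and i: "i = Suc (length u)"
    using split_at_adj[of i I] assms len by metis
  obtain u' v' where J: "J = u' @ J ! (i - 1) # J ! i # v'" and i': "i = Suc (length u')"
    using split_at_adj[of i J] assms len by metis
  define x y x' y' where "x = I ! (i - 1)" "y = I ! i" "x' = J ! (i - 1)" "y' = J ! i"
  note xy = this
  have IJ: "I = u @ x # y # v" "J = u' @ x' # y' # v'" using I J by (simp_all only: xy)
  have lens: "length u = length u'" "length v = length v'" using i i' len IJ by auto
  have p: "pact (adj i) I = u @ y # x # v" unfolding IJ i by (rule pact_adj_append)
  \<comment> \<open>\<open>a\<close> and \<open>b\<close> are the parities of the swapped pair and
    \<open>c\<close> that of the tail \<open>v\<close>. The swap keeps the total parity of the pair,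
    so the tail drops out.\<close>
  have s: "ksgn ((a + b) * (b + (a + c)) + (b + a) * (a + c)) * ksgn b = (ksgn (a * b) :: complex)" for a b c
    by (cases a; cases b; cases c) (simp_all add: ksgn_def)
  have e: "Pq k i I J = (if u = u' \<and> v = v' \<and> x' = y \<and> y' = x
      then scale (q powi sgn (int x - int y) * ksgn (par y)) 1 else 0)"
    using Pq_apply[OF lens, of x y k x' y'] assms(1,2) unfolding IJ i .
  have c: "J = pact (adj i) I \<longleftrightarrow> u = u' \<and> v = v' \<and> x' = y \<and> y' = x"
    unfolding p unfolding IJ using lens by auto
  have "gauge (Pq k i) I J = (if J = pact (adj i) I then scale (pcoef x y) 1 else 0)"
  proof (cases "J = pact (adj i) I")
    case True
    then have "gexp I J = (par x + par y) * (par y + (par x + lpar v)) + (par y + par x) * (par x + lpar v)"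
      unfolding p unfolding IJ by (simp add: gexp_append)
    then have "ksgn (gexp I J) * ksgn (par y) = (ksgn (par x * par y) :: complex)"
      by (simp only: s)
    then have "ksgn (gexp I J) * (q powi sgn (int x - int y) * ksgn (par y)) = pcoef x y"
      unfolding pcoef_def by (metis mult.left_commute)
    then show ?thesis using True e c unfolding gauge_def by simp
  next
    case False
    then show ?thesis using e c by (auto simp: gauge_def)
  qed
  then show ?thesis by (simp only: xy)
qed

lemma even_Pq:
  assumes "1 \<le> i" "i < k"
  shows "even_tensor k (Pq k i)"
proof (rule even_tensorI)
  fix I J assume IJ: "I \<in> indices k" "J \<in> indices k"
  have "lpar (pact (adj i) I) = lpar I"
    by (rule lpar_pact, rule adj_permutes) (use assms length_indices[OF IJ(1)] in auto)
  then show "gauge (Pq k i) I J \<in> grade (lpar I + lpar J)"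
    using IJ assms by (auto simp: gauge_Pq one_in_grade scale_in_grade subspace_0 subspace_grade)
qed

lemma gauge_Pq_tmul:
  assumes "even_tensor k Y" "I \<in> indices k" "J \<in> indices k" "1 \<le> i" "i < k"
  shows "gauge (Pq k i \<star> Y) I J = scale (pcoef (I ! (i - 1)) (I ! i)) (gauge Y (pact (adj i) I) J)"
proof -
  have "pact (adj i) I \<in> indices k"
    using assms by (intro pact_in_indices adj_permutes) auto
  then show ?thesis
    using assms sum_delta_mult[of "indices k" "pact (adj i) I" "scale (pcoef (I ! (i - 1)) (I ! i)) 1" "\<lambda>K. gauge Y K J"]
    by (simp add: gauge_tmul gauge_Pq)
qed

lemma place_apply:
  assumes "length u = length u'" "length v = length v'"
    and "u @ x # v \<in> indices k" "u' @ x' # v' \<in> indices k"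
  shows "place k (Suc (length u)) B (u @ x # v) (u' @ x' # v')
    = (if u = u' \<and> v = v' then scale (ksgn (par x * par x' + par x')) (B x x') else 0)"
proof -
  have k: "k = Suc (length u + length v)" and u: "u \<in> indices (length u)" and v: "v \<in> indices (length v)"
    and x: "x \<in> {1..m + n}" using assms(3) by (auto simp: indices_def)
  have x': "x' \<in> {1..m + n}" using assms(4) by (auto simp: indices_def)
  let ?d = "if u = u' \<and> v = v' then 1 else 0 :: complex"
  have t: "ptens (B i j) (replicate (length u) mid @ [munit i j] @ replicate (length v) mid)
      (u @ x # v) (u' @ x' # v')
    = (if i = x then if j = x' then scale ?d (B i j) else 0 else 0)" for i j
    using assms(1,2) u v by (auto simp: ptens_tcoef tcoef_append tcoef_mid munit_def)
  have "place k (Suc (length u)) B (u @ x # v) (u' @ x' # v')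
    = (\<Sum>i\<in>{1..m + n}. \<Sum>j\<in>{1..m + n}. if i = x then if j = x' then
         scale (ksgn (par i * par j + par j)) (scale ?d (B i j)) else 0 else 0)"
    unfolding place_def sum_fun_apply tscale_def k
    by (intro sum.cong refl) (simp add: t[simplified] del: scale_scale)
  also have "\<dots> = scale (ksgn (par x * par x' + par x')) (scale ?d (B x x'))"
    using x x' by (intro sum_delta_delta) auto
  finally show ?thesis by simp
qed

text \<open>The sign \<open>(-1)^(ij+j)\<close> in the embedding of a matrix is what the gauge takes
  away; there remains the sign of the entry against the parity \<open>lpar v\<close> of the places
  behind it.\<close>

lemma gauge_place:
  assumes "length u = length u'" "length v = length v'"
    and "u @ x # v \<in> indices k" "u' @ x' # v' \<in> indices k"
  shows "gauge (place k (Suc (length u)) B) (u @ x # v) (u' @ x' # v')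
    = (if u = u' \<and> v = v' then scale (ksgn ((par x + par x') * lpar v)) (B x x') else 0)"
proof -
  have s: "ksgn ((a + b) * (b + c)) * ksgn (a * b + b) = (ksgn ((a + b) * c) :: complex)" for a b c
    by (cases a; cases b; cases c) (simp_all add: ksgn_def)
  show ?thesis
    unfolding gauge_def place_apply[OF assms] using assms(1) by (auto simp: gexp_append s)
qed

lemma even_place:
  assumes "super_matrix B" "1 \<le> a" "a \<le> k"
  shows "even_tensor k (place k a B)"
proof (rule even_tensorI)
  fix I J assume IJ: "I \<in> indices k" "J \<in> indices k"
  then have "length I = a - 1 + Suc (k - a)" "length J = a - 1 + Suc (k - a)"
    using assms by (auto simp: length_indices)
  then obtain u x v u' x' v' where *: "I = u @ x # v" "length u = a - 1" "length v = k - a"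
    "J = u' @ x' # v'" "length u' = a - 1" "length v' = k - a"
    by (metis split_length)
  then have "x \<in> {1..m + n}" "x' \<in> {1..m + n}" using IJ by (auto simp: indices_def)
  then have "B x x' \<in> grade (par x + par x')" using assms by (auto simp: super_matrix_def)
  moreover have "a = Suc (length u)" using * assms by simp
  moreover have "lpar u + (par x + lpar v) + (lpar u + (par x' + lpar v)) = par x + par x'"
    by (simp add: ac_simps)
  ultimately show "gauge (place k a B) I J \<in> grade (lpar I + lpar J)"
    using gauge_place[of u u' v v' x k x' B] IJ *
    by (auto intro: scale_in_grade subspace_0 subspace_grade simp: subspace_0[OF subspace_grade])
qed

text \<open>The matrix coefficients of \<open>B\<^sub>1 \<dots> B\<^sub>k\<close> after the change of signs.\<close>

fun mprod :: "(nat \<Rightarrow> nat \<Rightarrow> 'r) \<Rightarrow> nat list \<Rightarrow> nat list \<Rightarrow> 'r"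
  where
    "mprod B (i # I) (j # J) = scale (ksgn ((par i + par j) * lpar I)) (B i j * mprod B I J)"
  | "mprod B _ _ = 1"

lemma mprod_append:
  assumes "length I = length J"
  shows "mprod B (I @ K) (J @ L)
    = scale (ksgn ((lpar I + lpar J) * lpar K)) (mprod B I J * mprod B K L)"
  using assms
proof (induction I J rule: list_induct2)
  case (Cons i I j J)
  have s: "ksgn ((a + b) * (c + d)) * ksgn ((c + e) * d) = (ksgn ((a + c + (b + e)) * d) * ksgn ((a + b) * c) :: complex)"
    for a b c d e by (cases a; cases b; cases c; cases d; cases e) (simp_all add: ksgn_def)
  show ?case
    by (simp add: Cons.IH scale_mult_left[symmetric] scale_mult_right[symmetric] s mult.assoc)
qed simp

lemma even_foldr_place:
  assumes "super_matrix B" "set as \<subseteq> {1..k}"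
  shows "even_tensor k (foldr (\<lambda>a X. place k a B \<star> X) as (tone k))"
  using assms(2) by (induction as) (auto simp del: One_nat_def intro!: even_tone even_tmul even_place assms(1))

text \<open>The product is built up from its right end. Its factors sit at places beyond
  \<open>r\<close> only, so the first \<open>r\<close> indices pass through unchanged: this is the
  delta in \<open>u = u'\<close>.\<close>

lemma gauge_foldr_place:
  assumes "super_matrix B" "length u = r" "length u' = r" "length I = d" "length J = d"
    and "u @ I \<in> indices (r + d)" "u' @ J \<in> indices (r + d)"
  shows "gauge (foldr (\<lambda>a X. place (r + d) a B \<star> X) [Suc r..<r + d + 1] (tone (r + d))) (u @ I) (u' @ J)
    = (if u = u' then mprod B I J else 0)"
  using assms(2-)
proof (induction d arbitrary: r u u' I J)
  case 0
  then show ?case by (simp add: gauge_tone)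
next
  case (Suc d)
  obtain i I' j J' where IJ: "I = i # I'" "J = j # J'" "length I' = d" "length J' = d"
    using Suc.prems by (metis length_Suc_conv)
  let ?k = "r + Suc d"
  let ?d = "if u = u' then scale (ksgn ((par i + par j) * lpar I')) (B i j) * mprod B I' J' else 0"
  let ?rest = "foldr (\<lambda>a X. place ?k a B \<star> X) [Suc (Suc r)..<?k + 1] (tone ?k)"
  have uI: "u \<in> indices r" "u' \<in> indices r" "I' \<in> indices d" "J' \<in> indices d" "i \<in> {1..m+n}" "j \<in> {1..m+n}"
    using Suc.prems IJ by (auto simp: indices_def)
  have ev: "even_tensor ?k ?rest" by (rule even_foldr_place[OF assms(1)]) auto
  have up: "[Suc r..<?k + 1] = Suc r # [Suc (Suc r)..<?k + 1]" by (simp add: upt_conv_Cons del: upt_Suc)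
  have "gauge (place ?k (Suc r) B \<star> ?rest) (u @ I) (u' @ J)
    = (\<Sum>w\<in>indices r. \<Sum>x\<in>{1..m + n}. \<Sum>v\<in>indices d.
        gauge (place ?k (Suc r) B) (u @ I) (w @ x # v) * gauge ?rest (w @ x # v) (u' @ J))"
    unfolding gauge_tmul[OF ev Suc.prems(5,6)] by (simp only: sum_indices_add sum_indices_Suc)
  \<comment> \<open>The leftmost factor acts at place \<open>r + 1\<close> alone and the others
    leave that place untouched, so prefix, entry and suffix of the intermediate index are all
    forced.\<close>
  also have "\<dots> = (\<Sum>w\<in>indices r. \<Sum>x\<in>{1..m + n}. \<Sum>v\<in>indices d.
      if w = u then if x = j then if v = I' then ?d else 0 else 0 else 0)"
  proof -
    have "gauge (place ?k (Suc r) B) (u @ I) (w @ x # v) * gauge ?rest (w @ x # v) (u' @ J)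
      = (if w = u then if x = j then if v = I' then ?d else 0 else 0 else 0)"
      if *: "w \<in> indices r" "x \<in> {1..m + n}" "v \<in> indices d" for w x v
    proof -
      have wxv: "w @ x # v \<in> indices ?k" "length w = r" "length v = d" using * by (auto simp: indices_def)
      have 1: "gauge (place ?k (Suc r) B) (u @ I) (w @ x # v)
         = (if u = w \<and> I' = v then scale (ksgn ((par i + par x) * lpar I')) (B i x) else 0)"
        using gauge_place[of u w I' v i ?k x B] wxv Suc.prems IJ by simp
      have 2: "gauge ?rest ((w @ [x]) @ v) ((u' @ [j]) @ J') = (if w @ [x] = u' @ [j] then mprod B v J' else 0)"
        using Suc.IH[of "w @ [x]" "Suc r" "u' @ [j]" v J'] wxv Suc.prems IJ
        by (simp del: upt_Suc)
      show ?thesis unfolding 1 using 2 IJ(2) by (simp del: upt_Suc)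
    qed
    then show ?thesis by (intro sum.cong refl)
  qed
  also have "\<dots> = (if u = u' then mprod B I J else 0)"
    using uI by (subst sum_triple_delta) (auto simp: IJ scale_mult_left)
  finally show ?case by (simp only: up foldr_Cons comp_apply)
qed

lemma even_place_prod: "super_matrix B \<Longrightarrow> even_tensor k (place_prod k B)"
  unfolding place_prod_def by (rule even_foldr_place) auto

lemma gauge_place_prod:
  "\<lbrakk>super_matrix B; I \<in> indices k; J \<in> indices k\<rbrakk> \<Longrightarrow> gauge (place_prod k B) I J = mprod B I J"
  using gauge_foldr_place[of B "[]" 0 "[]" I k J] by (simp add: place_prod_def length_indices del: upt_Suc)


text \<open>Valid for every word, reduced or not: each further factor permutes the row index and
  contributes the scalar of \<open>coc_adj_comp\<close>.\<close>

lemma foldr_Pq: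
  assumes "set w \<subseteq> {1..<k}"
  shows "even_tensor k (foldr (\<lambda>i X. Pq k i \<star> X) w (tone k))"
    and "\<lbrakk>I \<in> indices k; J \<in> indices k\<rbrakk> \<Longrightarrow> gauge (foldr (\<lambda>i X. Pq k i \<star> X) w (tone k)) I J
      = (if I = pact (simple_comp w) J then scale (coc (simple_comp w) J) 1 else 0)"
  using assms
proof (induction w arbitrary: I)
  case Nil
  {
    case 1
    show ?case by (simp add: even_tone)
  next
    case 2
    have "foldr (\<lambda>i X. Pq k i \<star> X) [] (tone k) = tone k" by simp
    then show ?case using 2 by (simp only: simple_comp_simps pact_id coc_id gauge_tone scale_one)
  }
next
  case (Cons i w)
  have i: "1 \<le> i" "i < k" and w: "set w \<subseteq> {1..<k}" if "set (i # w) \<subseteq> {1..<k}" using that by auto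
  {
    case 1
    then show ?case using Cons.IH(1)[OF w] i by (auto intro!: even_tmul even_Pq)
  next
    case 2
    note i = i[OF 2(3)] and w = w[OF 2(3)]
    let ?L = "pact (simple_comp w) J"
    have len: "length I = k" "length J = k" using 2 length_indices by auto
    have s: "simple_comp w permutes {1..length J}" "adj i permutes {1..length J}"
      using simple_comp_permutes[OF w] i len by (auto intro!: adj_permutes)
    have I': "pact (adj i) I \<in> indices k"
      using 2 i by (intro pact_in_indices adj_permutes) auto
    have eq: "pact (simple_comp (i # w)) J = pact (adj i) ?L"
      by (simp only: simple_comp_simps pact_comp s)
    have c: "pact (adj i) I = ?L \<longleftrightarrow> I = pact (adj i) ?L"
      using pact_adj_adj[of i I] pact_adj_adj[of i ?L] i len by auto
    have "gauge (foldr (\<lambda>i X. Pq k i \<star> X) (i # w) (tone k)) I J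
      = scale (pcoef (I ! (i - 1)) (I ! i)) (if pact (adj i) I = ?L then scale (coc (simple_comp w) J) 1 else 0)"
      using gauge_Pq_tmul[OF Cons.IH(1)[OF w] 2(1,2) i] Cons.IH(2)[OF I' 2(2) w]
      by (simp only: foldr_Cons comp_apply)
    also have "\<dots> = (if I = pact (simple_comp (i # w)) J then scale (coc (simple_comp (i # w)) J) 1 else 0)"
    proof (cases "I = pact (adj i) ?L")
      case True
      have "I ! (i - 1) = ?L ! i" "I ! i = ?L ! (i - 1)"
        using pact_adj_nth[of i ?L] i len unfolding True by auto
      then show ?thesis
        unfolding c eq using True coc_adj_comp[OF s(1), of i] i len
        by (simp del: One_nat_def only: simple_comp_simps scale_scale if_True refl length_pact)
    next
      case False
      then show ?thesis unfolding c eq by simp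
    qed
    finally show ?case .
  }
qed

lemma word_for_iff: "word_for k \<sigma> w \<longleftrightarrow> set w \<subseteq> {1..<k} \<and> simple_comp w = \<sigma>"
  by (simp add: word_for_def simple_comp_def adj_def)

text \<open>The result depends on \<open>\<sigma>\<close> only, so the choice made by
  \<open>SOME\<close> leaves no trace. A reduced word exists because some word does, and lengths are
  well-founded.\<close>

lemma gauge_Pperm:
  assumes "\<sigma> permutes {1..k}" "I \<in> indices k" "J \<in> indices k"
  shows "gauge (Pperm k \<sigma>) I J = (if I = pact \<sigma> J then scale (coc \<sigma> J) 1 else 0)"
proof -
  obtain w where "word_for k \<sigma> w"
    using permutes_simple_comp[OF assms(1)] by (auto simp: word_for_iff)
  then have "\<exists>w. reduced_word k \<sigma> w"
    unfolding reduced_word_def by (rule ex_has_least_nat)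
  then have "reduced_word k \<sigma> (SOME w. reduced_word k \<sigma> w)" by (rule someI_ex)
  then have "set (SOME w. reduced_word k \<sigma> w) \<subseteq> {1..<k}" "simple_comp (SOME w. reduced_word k \<sigma> w) = \<sigma>"
    by (simp_all only: reduced_word_def word_for_iff)
  then show ?thesis using foldr_Pq(2)[OF _ assms(2,3)] unfolding Pperm_def by simp
qed

lemma funpow_str_first:
  "(str_first ^^ k) X I J = (\<Sum>K\<in>indices k. ksgn (lpar K) * X (K @ I) (K @ J))"
  by (induction k arbitrary: X)
     (simp_all add: funpow_Suc_right sum_indices_Suc str_first_def ksgn_add sum_distrib_left mult.assoc
        sum.swap[of _ "indices _"] ksgn_left_commute[of "lpar _" "par _"] del: funpow.simps(2))

lemma str_all_gauge: "str_all k X = (\<Sum>K\<in>indices k. scale (ksgn (lpar K)) (gauge X K K))"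
  by (simp add: str_all_def funpow_str_first gauge_def scale_ksgn)

section \<open>Traces attached to permutations\<close>

text \<open>The supertrace of \<open>Pperm k \<sigma> \<star> place_prod k B\<close> in the gauge:
  as the matrix of \<open>\<sigma>\<close> is monomial, one of the two index sums collapses
  (\<open>perm_trace_alt\<close>).\<close>

definition perm_trace :: "(nat \<Rightarrow> nat \<Rightarrow> 'r) \<Rightarrow> nat \<Rightarrow> (nat \<Rightarrow> nat) \<Rightarrow> 'r"
  where "perm_trace B k \<sigma> = (\<Sum>J\<in>indices k. scale (ksgn (lpar J) * coc \<sigma> J) (mprod B J (pact \<sigma> J)))"

lemma perm_trace_alt:
  assumes "\<sigma> permutes {1..k}"
  shows "(\<Sum>K\<in>indices k. \<Sum>L\<in>indices k. scale (ksgn (lpar K))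
      ((if K = pact \<sigma> L then scale (coc \<sigma> L) 1 else 0) * mprod B L K)) = perm_trace B k \<sigma>"
proof -
  have "(\<Sum>K\<in>indices k. scale (ksgn (lpar K)) ((if K = pact \<sigma> L then scale (coc \<sigma> L) 1 else 0) * mprod B L K))
    = scale (ksgn (lpar L) * coc \<sigma> L) (mprod B L (pact \<sigma> L))" if L: "L \<in> indices k" for L
  proof -
    have "lpar (pact \<sigma> L) = lpar L" using assms length_indices[OF L] by (intro lpar_pact) simp
    moreover have "pact \<sigma> L \<in> indices k" using assms L by (rule pact_in_indices)
    ultimately show ?thesis
      using sum_delta_mult[of "indices k" "pact \<sigma> L" "scale (coc \<sigma> L) 1"
          "\<lambda>K. scale (ksgn (lpar K)) (mprod B L K)"]
      by (simp add: scale_mult_right mult.commute)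
  qed
  then show ?thesis unfolding perm_trace_def by (subst sum.swap) simp
qed

text \<open>The weights cover both symmetrizers: \<open>d\<close> is 1 for \<open>Hsym\<close> and
  the sign for \<open>Asym\<close>.\<close>

lemma str_all_perm_sum:
  assumes "super_matrix B"
  shows "str_all k (tscale c (\<Sum>\<sigma> | \<sigma> permutes {1..k}. tscale (d \<sigma>) (Pperm k \<sigma>)) \<star> place_prod k B)
    = scale c (\<Sum>\<sigma> | \<sigma> permutes {1..k}. scale (d \<sigma>) (perm_trace B k \<sigma>))"
proof -
  let ?S = "{\<sigma>. \<sigma> permutes {1..k}}"
  let ?X = "tscale c (\<Sum>\<sigma>\<in>?S. tscale (d \<sigma>) (Pperm k \<sigma>))"
  let ?P = "\<lambda>\<sigma> K L. if K = pact \<sigma> L then scale (coc \<sigma> L) 1 else 0"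
  have X: "gauge ?X K L = scale c (\<Sum>\<sigma>\<in>?S. scale (d \<sigma>) (?P \<sigma> K L))"
    if "K \<in> indices k" "L \<in> indices k" for K L
  proof -
    have "gauge ?X K L = scale c (\<Sum>\<sigma>\<in>?S. scale (d \<sigma>) (gauge (Pperm k \<sigma>) K L))"
      by (simp add: gauge_def tscale_def sum_fun_apply scale_sum_right mult.commute mult.left_commute mult.assoc)
    also have "(\<Sum>\<sigma>\<in>?S. scale (d \<sigma>) (gauge (Pperm k \<sigma>) K L)) = (\<Sum>\<sigma>\<in>?S. scale (d \<sigma>) (?P \<sigma> K L))"
      by (intro sum.cong refl) (simp only: gauge_Pperm[OF _ that] mem_Collect_eq)
    finally show ?thesis .
  qed
  have "str_all k (?X \<star> place_prod k B)
    = (\<Sum>K\<in>indices k. \<Sum>L\<in>indices k. \<Sum>\<sigma>\<in>?S. scale (c * d \<sigma>) (scale (ksgn (lpar K)) (?P \<sigma> K L * mprod B L K)))"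
    unfolding str_all_gauge
  proof (rule sum.cong[OF refl])
    fix K assume K: "K \<in> indices k"
    have "gauge (?X \<star> place_prod k B) K K
      = (\<Sum>L\<in>indices k. scale c (\<Sum>\<sigma>\<in>?S. scale (d \<sigma>) (?P \<sigma> K L)) * mprod B L K)"
      unfolding gauge_tmul[OF even_place_prod[OF assms] K K]
      using K by (intro sum.cong refl) (simp only: X gauge_place_prod[OF assms])
    then show "scale (ksgn (lpar K)) (gauge (?X \<star> place_prod k B) K K)
      = (\<Sum>L\<in>indices k. \<Sum>\<sigma>\<in>?S. scale (c * d \<sigma>) (scale (ksgn (lpar K)) (?P \<sigma> K L * mprod B L K)))"
      by (simp only: scale_sum_right sum_distrib_right scale_mult_left[symmetric] scale_scale ac_simps)
  qed
  also have "\<dots> = (\<Sum>\<sigma>\<in>?S. \<Sum>K\<in>indices k. \<Sum>L\<in>indices k.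
      scale (c * d \<sigma>) (scale (ksgn (lpar K)) (?P \<sigma> K L * mprod B L K)))"
    by (rule trans[OF sum.cong[OF refl sum.swap] sum.swap])
  also have "\<dots> = (\<Sum>\<sigma>\<in>?S. scale (c * d \<sigma>) (perm_trace B k \<sigma>))"
    by (intro sum.cong refl) (simp only: mem_Collect_eq perm_trace_alt[symmetric] scale_sum_right)
  finally show ?thesis by (simp add: scale_sum_right)
qed

section \<open>The Manin condition in coordinates and the exchange relation\<close>

lemma gauge_two_places:
  assumes "super_matrix C" "x \<in> {1..m + n}" "y \<in> {1..m + n}" "x' \<in> {1..m + n}" "y' \<in> {1..m + n}"
  shows "gauge (place 2 1 B \<star> place 2 2 C) [x, y] [x', y']
    = scale (ksgn ((par x + par x') * par y)) (B x x' * C y y')"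
proof -
  have two: "2 = Suc (Suc 0)" by simp
  have ind: "[a, b] \<in> indices 2 \<longleftrightarrow> a \<in> {1..m + n} \<and> b \<in> {1..m + n}" for a b
    by (auto simp: indices_def)
  have ev: "even_tensor 2 (place 2 2 C)" using assms by (intro even_place) auto
  have "gauge (place 2 1 B \<star> place 2 2 C) [x, y] [x', y']
    = (\<Sum>c\<in>{1..m + n}. \<Sum>d\<in>{1..m + n}.
        gauge (place 2 1 B) [x, y] [c, d] * gauge (place 2 2 C) [c, d] [x', y'])"
    using assms by (subst gauge_tmul[OF ev]) (simp_all add: ind two sum_indices_Suc)
  also have "\<dots> = (\<Sum>c\<in>{1..m + n}. \<Sum>d\<in>{1..m + n}. if c = x' then if d = y then
      scale (ksgn ((par x + par x') * par y)) (B x x' * C y y') else 0 else 0)"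
  proof (intro sum.cong refl)
    fix c d assume cd: "c \<in> {1..m + n}" "d \<in> {1..m + n}"
    have "gauge (place 2 1 B) [x, y] [c, d] = (if y = d then scale (ksgn ((par x + par c) * par y)) (B x c) else 0)"
      using gauge_place[of "[]" "[]" "[y]" "[d]" x 2 c B] assms cd by (simp add: ind)
    moreover have "gauge (place 2 2 C) [c, d] [x', y'] = (if c = x' then C d y' else 0)"
      using gauge_place[of "[c]" "[x']" "[]" "[]" d 2 y' C] assms cd by (simp add: ind numeral_2_eq_2)
    ultimately show "gauge (place 2 1 B) [x, y] [c, d] * gauge (place 2 2 C) [c, d] [x', y']
      = (if c = x' then if d = y then scale (ksgn ((par x + par x') * par y)) (B x x' * C y y') else 0 else 0)"
      by (simp add: scale_mult_left)
  qed
  also have "\<dots> = scale (ksgn ((par x + par x') * par y)) (B x x' * C y y')"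
    using assms by (intro sum_delta_delta) auto
  finally show ?thesis .
qed

text \<open>Regroups the left-bracketed products in the Manin condition and in \<open>mstar\<close>,
  so that the two placed matrices are multiplied first.\<close>

lemma gauge_tmul_assoc:
  assumes "even_tensor k Y" "even_tensor k Z" "I \<in> indices k" "J \<in> indices k"
  shows "gauge (X \<star> Y \<star> Z) I J = gauge (X \<star> (Y \<star> Z)) I J"
proof -
  have "gauge (X \<star> Y \<star> Z) I J
    = (\<Sum>K\<in>indices k. \<Sum>L\<in>indices k. gauge X I L * (gauge Y L K * gauge Z K J))"
    unfolding gauge_tmul[OF assms(2-4)]
    by (intro sum.cong refl) (simp only: gauge_tmul[OF assms(1,3)] sum_distrib_right mult.assoc)
  also have "\<dots> = (\<Sum>L\<in>indices k. \<Sum>K\<in>indices k. gauge X I L * (gauge Y L K * gauge Z K J))"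
    by (rule sum.swap)
  also have "\<dots> = gauge (X \<star> (Y \<star> Z)) I J"
    unfolding gauge_tmul[OF even_tmul[OF assms(1,2)] assms(3,4)]
    by (intro sum.cong refl) (simp only: gauge_tmul[OF assms(2) _ assms(4)] sum_distrib_left)
  finally show ?thesis .
qed

lemma gauge_add: "gauge (X + Y) I J = gauge X I J + gauge Y I J"
  by (simp add: gauge_def scale_right_distrib)

lemma gauge_diff: "gauge (X - Y) I J = gauge X I J - gauge Y I J"
  by (simp add: gauge_def scale_right_diff_distrib)

text \<open>The entry of \<open>(1 - P) G (1 + P) = 0\<close> at row \<open>xy\<close> and column
  \<open>x'y'\<close>: on the left \<open>P\<close> swaps the rows of \<open>G\<close>, on the right
  its columns. The right-hand scalar is \<open>pcoef y' x'\<close> because the row of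
  \<open>P\<close> that meets column \<open>x'y'\<close> is \<open>y'x'\<close>.\<close>

lemma manin_entries:
  assumes M: "q_super_manin B" and xy: "x \<in> {1..m + n}" "y \<in> {1..m + n}" "x' \<in> {1..m + n}" "y' \<in> {1..m + n}"
  shows "mprod B [x, y] [x', y'] + scale (pcoef y' x') (mprod B [x, y] [y', x'])
    = scale (pcoef x y) (mprod B [y, x] [x', y'] + scale (pcoef y' x') (mprod B [y, x] [y', x']))"
proof -
  let ?P = "Pq 2 1" and ?G = "place 2 1 B \<star> place 2 2 B"
  have B: "super_matrix B" using M by (simp add: q_super_manin_def)
  have ind: "[a, b] \<in> indices 2 \<longleftrightarrow> a \<in> {1..m + n} \<and> b \<in> {1..m + n}" for a b
    by (auto simp: indices_def)
  have sw: "pact (adj (Suc 0)) [a, b] = [b, a]" for a b :: nat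
    using pact_adj_append[of "[]" a b "[]"] by simp
  have ev: "even_tensor 2 (place 2 1 B)" "even_tensor 2 (place 2 2 B)" "even_tensor 2 ?P"
    using B by (auto intro: even_place even_Pq)
  then have evG: "even_tensor 2 ?G" by (intro even_tmul)
  have evP: "even_tensor 2 (tone 2 + ?P)"
    using even_tone[of 2] ev(3) subspace_add[OF subspace_grade] by (auto simp: even_tensor_def)
  have G: "gauge ?G [a, b] [c, d] = mprod B [a, b] [c, d]"
    if "a \<in> {1..m + n}" "b \<in> {1..m + n}" "c \<in> {1..m + n}" "d \<in> {1..m + n}" for a b c d
    using gauge_two_places[OF B that, of B] by simp
  have P: "gauge ?P [a, b] K = (if K = [b, a] then scale (pcoef a b) 1 else 0)"
    if "a \<in> {1..m + n}" "b \<in> {1..m + n}" "K \<in> indices 2" for a b K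
    using gauge_Pq[of "[a, b]" 2 K 1] that by (simp add: ind sw)
  have T: "gauge (tone 2) [a, b] K = (if K = [a, b] then 1 else 0)"
    if "a \<in> {1..m + n}" "b \<in> {1..m + n}" "K \<in> indices 2" for a b K
    using gauge_tone[of "[a, b]" 2 K] that by (auto simp: ind)
  have left: "gauge ((tone 2 - ?P) \<star> ?G) [x, y] [c, d]
      = mprod B [x, y] [c, d] - scale (pcoef x y) (mprod B [y, x] [c, d])"
    if cd: "c \<in> {1..m + n}" "d \<in> {1..m + n}" for c d
  proof -
    have "gauge ((tone 2 - ?P) \<star> ?G) [x, y] [c, d] = (\<Sum>K\<in>indices 2.
        ((if K = [x, y] then 1 else 0) - (if K = [y, x] then scale (pcoef x y) 1 else 0)) * gauge ?G K [c, d])"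
      using xy cd by (subst gauge_tmul[OF evG]) (simp_all add: ind gauge_diff P T del: One_nat_def)
    also have "\<dots> = gauge ?G [x, y] [c, d] - scale (pcoef x y) 1 * gauge ?G [y, x] [c, d]"
      using sum_delta_mult[of "indices 2" "[x, y]" 1 "\<lambda>K. gauge ?G K [c, d]"]
        sum_delta_mult[of "indices 2" "[y, x]" "scale (pcoef x y) 1" "\<lambda>K. gauge ?G K [c, d]"] xy
      by (simp add: left_diff_distrib sum_subtractf ind)
    finally show ?thesis using xy cd by (simp only: G scale_one_mult)
  qed
  have "0 = gauge ((tone 2 - ?P) \<star> place 2 1 B \<star> place 2 2 B \<star> (tone 2 + ?P)) [x, y] [x', y']"
    using M by (simp add: q_super_manin_def gauge_def)
  also have "\<dots> = (\<Sum>K\<in>indices 2. gauge ((tone 2 - ?P) \<star> place 2 1 B \<star> place 2 2 B) [x, y] K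
      * gauge (tone 2 + ?P) K [x', y'])"
    using xy by (subst gauge_tmul[OF evP]) (simp_all add: ind)
  also have "\<dots> = (\<Sum>K\<in>indices 2. gauge ((tone 2 - ?P) \<star> ?G) [x, y] K
      * gauge (tone 2 + ?P) K [x', y'])"
    using xy by (intro sum.cong refl) (subst gauge_tmul_assoc[OF ev(1,2)], simp_all add: ind)
  also have "\<dots> = (\<Sum>c\<in>{1..m + n}. \<Sum>d\<in>{1..m + n}.
      gauge ((tone 2 - ?P) \<star> ?G) [x, y] [c, d] * gauge (tone 2 + ?P) [c, d] [x', y'])"
    by (simp add: numeral_2_eq_2 sum_indices_Suc)
  also have "\<dots> = (\<Sum>c\<in>{1..m + n}. \<Sum>d\<in>{1..m + n}.
      (if c = x' then if d = y' then gauge ((tone 2 - ?P) \<star> ?G) [x, y] [c, d] else 0 else 0)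
    + (if c = y' then if d = x' then scale (pcoef c d) (gauge ((tone 2 - ?P) \<star> ?G) [x, y] [c, d]) else 0 else 0))"
    using xy by (intro sum.cong refl) (simp add: gauge_add P T ind distrib_left del: One_nat_def)
  also have "\<dots> = gauge ((tone 2 - ?P) \<star> ?G) [x, y] [x', y']
      + scale (pcoef y' x') (gauge ((tone 2 - ?P) \<star> ?G) [x, y] [y', x'])"
    using xy by (simp only: sum.distrib sum_delta_delta finite_atLeastAtMost)
  also have "\<dots> = mprod B [x, y] [x', y'] - scale (pcoef x y) (mprod B [y, x] [x', y'])
      + scale (pcoef y' x') (mprod B [x, y] [y', x'] - scale (pcoef x y) (mprod B [y, x] [y', x']))"
    using xy by (simp only: left)
  finally show ?thesis
    by (simp add: scale_right_distrib scale_right_diff_distrib mult.commute algebra_simps)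
qed

text \<open>The relation at two neighbouring places inside a longer word. Swapping keeps the total
  parity of a pair, so the sign \<open>s\<close> that separates the pair from its surroundings is
  common to all four terms.\<close>

lemma manin_exchange:
  assumes M: "q_super_manin B" and IJ: "I \<in> indices k" "J \<in> indices k" and b: "1 \<le> b" "b < k"
  shows "mprod B I J + scale (pcoef (J ! b) (J ! (b - 1))) (mprod B I (pact (adj b) J))
    = scale (pcoef (I ! (b - 1)) (I ! b)) (mprod B (pact (adj b) I) J
       + scale (pcoef (J ! b) (J ! (b - 1))) (mprod B (pact (adj b) I) (pact (adj b) J)))"
proof -
  have len: "length I = k" "length J = k" using IJ length_indices by auto
  define x y x' y' where "x = I ! (b - 1)" "y = I ! b" "x' = J ! (b - 1)" "y' = J ! b"
  note xy = this
  obtain u v where I: "I = u @ x # y # v" and i: "b = Suc (length u)"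
    using split_at_adj[of b I] b len unfolding xy by metis
  obtain u' v' where J: "J = u' @ x' # y' # v'" and i': "b = Suc (length u')"
    using split_at_adj[of b J] b len unfolding xy by metis
  have lens: "length u = length u'" "length v = length v'" using i i' len I J by auto
  have p: "pact (adj b) I = u @ y # x # v" "pact (adj b) J = u' @ y' # x' # v'"
    unfolding I J using i i' pact_adj_append by metis+
  define s :: complex where "s = ksgn ((lpar u + lpar u') * (par x + (par y + lpar v)))
     * ksgn ((par x + par y + (par x' + par y')) * lpar v)"
  have fac: "mprod B (u @ a # c # v) (u' @ a' # c' # v')
      = scale s (mprod B u u' * (mprod B [a, c] [a', c'] * mprod B v v'))"
    if "a + c = x + y \<and> {a, c} = {x, y}" "a' + c' = x' + y' \<and> {a', c'} = {x', y'}" for a c a' c'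
  proof -
    have e: "par a + par c = par x + par y" "par a' + par c' = par x' + par y'"
      using that by (auto simp: doubleton_eq_iff ac_simps)
    have e': "par a + (par c + w) = par x + (par y + w)" for w
      using e(1) by (metis add.assoc)
    have "mprod B (u @ ([a, c] @ v)) (u' @ ([a', c'] @ v'))
      = scale (ksgn ((lpar u + lpar u') * (par a + (par c + lpar v))))
         (mprod B u u' * scale (ksgn ((par a + par c + (par a' + par c')) * lpar v)) (mprod B [a, c] [a', c'] * mprod B v v'))"
      using mprod_append[OF lens(1), of B "[a, c] @ v" "[a', c'] @ v'"] mprod_append[of "[a, c]" "[a', c']" B v v']
      by (simp only: lpar_simps list.size add_0_right add.assoc)
    then show ?thesis
      unfolding e e' s_def by (simp add: scale_mult_right[symmetric] add.assoc)
  qed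
  have N: "x \<in> {1..m + n}" "y \<in> {1..m + n}" "x' \<in> {1..m + n}" "y' \<in> {1..m + n}"
    using IJ I J by (auto simp: indices_def)
  let ?g = "\<lambda>Z. scale s (mprod B u u' * (Z * mprod B v v'))"
  have lin: "?g (X + scale c Y) = ?g X + scale c (?g Y)" "?g (scale c Y) = scale c (?g Y)" for X Y c
    by (simp_all add: scale_mult_left[symmetric] scale_mult_right[symmetric] distrib_left distrib_right
        scale_right_distrib mult.commute)
  have f: "mprod B I J = ?g (mprod B [x, y] [x', y'])"
    "mprod B I (pact (adj b) J) = ?g (mprod B [x, y] [y', x'])"
    "mprod B (pact (adj b) I) J = ?g (mprod B [y, x] [x', y'])"
    "mprod B (pact (adj b) I) (pact (adj b) J) = ?g (mprod B [y, x] [y', x'])"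
    unfolding p unfolding I J by (rule fac; auto)+
  show ?thesis
    using arg_cong[OF manin_entries[OF M N], of ?g] unfolding f xy[symmetric] by (simp only: lin)
qed

text \<open>With \<open>P\<close> the flip at \<open>b\<close>: \<open>tr(M (1 + P) P_\<sigma>) =
  tr(P M (1 + P) P_\<sigma>) = tr(M (1 + P) P_\<sigma> P)\<close>. The first equality is the Manin
  condition, the second is cyclicity, valid because the gauged entries of \<open>P\<close> are
  scalars. The proof reads this chain from right to left.\<close>

lemma perm_trace_exchange:
  assumes M: "q_super_manin B" and \<sigma>: "\<sigma> permutes {1..k}" and b: "1 \<le> b" "b < k"
  shows "perm_trace B k \<sigma> + perm_trace B k (adj b \<circ> \<sigma>)
    = perm_trace B k (\<sigma> \<circ> adj b) + perm_trace B k (adj b \<circ> (\<sigma> \<circ> adj b))"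
proof -
  have adjp: "adj b permutes {1..k}" using b by (intro adj_permutes) auto
  let ?c = "\<lambda>L. pcoef (L ! b) (L ! (b - 1))"
  have left: "perm_trace B k \<rho> + perm_trace B k (adj b \<circ> \<rho>)
    = (\<Sum>J\<in>indices k. scale (ksgn (lpar J) * coc \<rho> J)
        (mprod B J (pact \<rho> J) + scale (?c (pact \<rho> J)) (mprod B J (pact (adj b) (pact \<rho> J)))))"
    if \<rho>: "\<rho> permutes {1..k}" for \<rho>
    unfolding perm_trace_def sum.distrib[symmetric]
  proof (rule sum.cong[OF refl])
    fix J assume "J \<in> indices k"
    then have J: "\<rho> permutes {1..length J}" "adj b permutes {1..length J}" "b < length J"
      using \<rho> adjp b by (simp_all only: length_indices)
    show "scale (ksgn (lpar J) * coc \<rho> J) (mprod B J (pact \<rho> J)) +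
         scale (ksgn (lpar J) * coc (adj b \<circ> \<rho>) J) (mprod B J (pact (adj b \<circ> \<rho>) J)) =
         scale (ksgn (lpar J) * coc \<rho> J)
          (mprod B J (pact \<rho> J) + scale (?c (pact \<rho> J)) (mprod B J (pact (adj b) (pact \<rho> J))))"
      by (simp only: pact_comp[OF J(2,1)] coc_adj_comp[OF J(1) b(1) J(3)] scale_right_distrib scale_scale ac_simps)
  qed
  have comp: "\<sigma> \<circ> adj b permutes {1..k}" using \<sigma> adjp by (intro permutes_compose)
  have "perm_trace B k (\<sigma> \<circ> adj b) + perm_trace B k (adj b \<circ> (\<sigma> \<circ> adj b))
    = (\<Sum>J\<in>indices k. scale (ksgn (lpar J) * (coc \<sigma> (pact (adj b) J) * ?c J))
        (mprod B J (pact \<sigma> (pact (adj b) J))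
         + scale (?c (pact \<sigma> (pact (adj b) J))) (mprod B J (pact (adj b) (pact \<sigma> (pact (adj b) J))))))"
    unfolding left[OF comp]
  proof (rule sum.cong[OF refl])
    fix J assume "J \<in> indices k"
    then have J: "\<sigma> permutes {1..length J}" "adj b permutes {1..length J}" "b < length J"
      using \<sigma> adjp b by (simp_all only: length_indices)
    show "scale (ksgn (lpar J) * coc (\<sigma> \<circ> adj b) J)
       (mprod B J (pact (\<sigma> \<circ> adj b) J)
         + scale (?c (pact (\<sigma> \<circ> adj b) J)) (mprod B J (pact (adj b) (pact (\<sigma> \<circ> adj b) J))))
      = scale (ksgn (lpar J) * (coc \<sigma> (pact (adj b) J) * ?c J))
        (mprod B J (pact \<sigma> (pact (adj b) J))
         + scale (?c (pact \<sigma> (pact (adj b) J))) (mprod B J (pact (adj b) (pact \<sigma> (pact (adj b) J)))))"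
      by (simp only: pact_comp[OF J(1,2)] coc_comp[OF J(1,2)] coc_adj[OF b(1) J(3)])
  qed
  \<comment> \<open>Cyclicity: renaming \<open>J\<close> to \<open>pact (adj b) J\<close> moves the
    flip to the row index of the word, and the parity in the supertrace is unaffected.\<close>
  also have "\<dots> = (\<Sum>J\<in>indices k. scale (ksgn (lpar J) * (coc \<sigma> J * pcoef (J ! (b - 1)) (J ! b)))
        (mprod B (pact (adj b) J) (pact \<sigma> J)
         + scale (?c (pact \<sigma> J)) (mprod B (pact (adj b) J) (pact (adj b) (pact \<sigma> J)))))"
  proof (subst sum_indices_pact[OF adjp, symmetric], rule sum.cong[OF refl])
    fix J assume "J \<in> indices k"
    then have J: "adj b permutes {1..length J}" "b < length J"
      using adjp b by (simp_all only: length_indices)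
    show "scale (ksgn (lpar (pact (adj b) J)) * (coc \<sigma> (pact (adj b) (pact (adj b) J)) * ?c (pact (adj b) J)))
        (mprod B (pact (adj b) J) (pact \<sigma> (pact (adj b) (pact (adj b) J)))
         + scale (?c (pact \<sigma> (pact (adj b) (pact (adj b) J)))) (mprod B (pact (adj b) J) (pact (adj b) (pact \<sigma> (pact (adj b) (pact (adj b) J))))))
      = scale (ksgn (lpar J) * (coc \<sigma> J * pcoef (J ! (b - 1)) (J ! b)))
        (mprod B (pact (adj b) J) (pact \<sigma> J)
         + scale (?c (pact \<sigma> J)) (mprod B (pact (adj b) J) (pact (adj b) (pact \<sigma> J))))"
      by (simp only: pact_adj_adj[OF b(1) J(2)] pact_adj_nth[OF b(1) J(2)] lpar_pact[OF J(1)])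
  qed
  also have "\<dots> = perm_trace B k \<sigma> + perm_trace B k (adj b \<circ> \<sigma>)"
    unfolding left[OF \<sigma>]
  proof (rule sum.cong[OF refl])
    fix J assume J: "J \<in> indices k"
    show "scale (ksgn (lpar J) * (coc \<sigma> J * pcoef (J ! (b - 1)) (J ! b)))
        (mprod B (pact (adj b) J) (pact \<sigma> J)
         + scale (?c (pact \<sigma> J)) (mprod B (pact (adj b) J) (pact (adj b) (pact \<sigma> J))))
      = scale (ksgn (lpar J) * coc \<sigma> J)
        (mprod B J (pact \<sigma> J) + scale (?c (pact \<sigma> J)) (mprod B J (pact (adj b) (pact \<sigma> J))))"
      unfolding manin_exchange[OF M J pact_in_indices[OF \<sigma> J] b] by (simp only: scale_scale ac_simps)
  qed
  finally show ?thesis ..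
qed

end

section \<open>Sums over block permutations, the reversal, and signs\<close>

lemma bij_betw_shift: "bij_betw (shift r) {\<sigma>. \<sigma> permutes {1..s}} {\<sigma>. \<sigma> permutes {r+1..r+s}}"
proof -
  have inj: "inj_on (shift r) {\<sigma>. \<sigma> permutes {1..s}}"
  proof (rule inj_onI, rule ext)
    fix \<sigma> \<tau> a
    assume p: "\<sigma> \<in> {\<sigma>. \<sigma> permutes {1..s}}" "\<tau> \<in> {\<sigma>. \<sigma> permutes {1..s}}" and eq: "shift r \<sigma> = shift r \<tau>"
    show "\<sigma> a = \<tau> a"
    proof (cases "a = 0")
      case True
      then show ?thesis using p permutes_not_in[of \<sigma> "{1..s}" 0] permutes_not_in[of \<tau> "{1..s}" 0] by simp
    next
      case False
      then show ?thesis using fun_cong[OF eq, of "a + r"] by (simp add: shift_def)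
    qed
  qed
  have "shift r ` {\<sigma>. \<sigma> permutes {1..s}} = {\<sigma>. \<sigma> permutes {r+1..r+s}}"
  proof (rule card_subset_eq)
    show "finite {\<sigma>. \<sigma> permutes {r+1..r+s}}" by (rule finite_permutations) simp
    show "shift r ` {\<sigma>. \<sigma> permutes {1..s}} \<subseteq> {\<sigma>. \<sigma> permutes {r+1..r+s}}"
      by (auto intro: shift_permutes simp del: One_nat_def Suc_eq_plus1 add_Suc_right)
    have "card {\<sigma>. \<sigma> permutes {1..s}} = fact s" "card {\<sigma>. \<sigma> permutes {r+1..r+s}} = fact s"
      by (rule card_permutations; simp)+
    then show "card (shift r ` {\<sigma>. \<sigma> permutes {1..s}}) = card {\<sigma>. \<sigma> permutes {r+1..r+s}}"
      using card_image[OF inj] by simp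
  qed
  then show ?thesis using inj by (simp only: bij_betw_def simp_thms)
qed

lemma sum_permutes_shift:
  "(\<Sum>\<sigma> | \<sigma> permutes {r+1..r+s}. f \<sigma>) = (\<Sum>\<sigma> | \<sigma> permutes {1..s}. f (shift r \<sigma>))"
  by (rule sum.reindex_bij_betw[OF bij_betw_shift, symmetric])

lemma shift_commute:
  assumes "\<rho> permutes {1..r}" "\<sigma> permutes {1..s}"
  shows "shift r \<sigma> \<circ> \<rho> = \<rho> \<circ> shift r \<sigma>"
proof
  fix a
  show "(shift r \<sigma> \<circ> \<rho>) a = (\<rho> \<circ> shift r \<sigma>) a"
  proof (cases "a \<le> r")
    case True
    have "\<rho> a \<le> r"
    proof (cases "a \<in> {1..r}")
      case True
      then show ?thesis using permutes_in[OF assms(1) True] by simp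
    qed (use True permutes_not_in[OF assms(1)] in simp)
    then show ?thesis using True by (simp add: shift_def)
  next
    case False
    then have "\<rho> a = a" by (intro permutes_not_in[OF assms(1)]) simp
    moreover have "shift r \<sigma> a > r"
    proof (cases "a - r \<in> {1..s}")
      case True
      then show ?thesis using permutes_in[OF assms(2) True] False by (simp add: shift_def)
    qed (use False permutes_not_in[OF assms(2)] in \<open>simp add: shift_def\<close>)
    then have "\<rho> (shift r \<sigma> a) = shift r \<sigma> a" by (intro permutes_not_in[OF assms(1)]) simp
    ultimately show ?thesis by simp
  qed
qed

definition reversal :: "nat \<Rightarrow> nat \<Rightarrow> nat"
  where "reversal k a = (if a \<in> {1..k} then k + 1 - a else a)"

lemma reversal_reversal [simp]: "reversal k (reversal k a) = a"
  by (auto simp: reversal_def)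

lemma reversal_permutes: "reversal k permutes {1..k}"
  by (rule bij_imp_permutes, rule bij_betw_byWitness[of _ "reversal k"]) (auto simp: reversal_def)

lemma bij_permutesI: "\<lbrakk>bij p; \<And>a. a \<notin> S \<Longrightarrow> p a = a\<rbrakk> \<Longrightarrow> p permutes S"
  unfolding permutes_def bij_iff by blast

lemma reversal_conj_permutes:
  assumes "\<sigma> permutes {r+1..k}" 
  shows "reversal k \<circ> \<sigma> \<circ> reversal k permutes {1..k-r}"
proof (rule bij_permutesI)
  show "bij (reversal k \<circ> \<sigma> \<circ> reversal k)"
    using permutes_bij[OF assms] permutes_bij[OF reversal_permutes[of k]] by (intro bij_comp)
  fix a assume "a \<notin> {1..k-r}"
  then have "reversal k a \<notin> {r+1..k}" by (auto simp: reversal_def split: if_splits)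
  then have "\<sigma> (reversal k a) = reversal k a" by (rule permutes_not_in[OF assms])
  then show "(reversal k \<circ> \<sigma> \<circ> reversal k) a = a" by simp
qed

lemma reversal_conj_permutes':
  assumes "\<sigma> permutes {1..k-r}"
  shows "reversal k \<circ> \<sigma> \<circ> reversal k permutes {r+1..k}"
proof (rule bij_permutesI)
  show "bij (reversal k \<circ> \<sigma> \<circ> reversal k)"
    using permutes_bij[OF assms] permutes_bij[OF reversal_permutes[of k]] by (intro bij_comp)
  fix a assume "a \<notin> {r+1..k}"
  then have "reversal k a \<notin> {1..k-r}" by (auto simp: reversal_def split: if_splits)
  then have "\<sigma> (reversal k a) = reversal k a" by (rule permutes_not_in[OF assms])
  then show "(reversal k \<circ> \<sigma> \<circ> reversal k) a = a" by simp
qed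

lemma reversal_conj_conj: "reversal k \<circ> (reversal k \<circ> \<sigma> \<circ> reversal k) \<circ> reversal k = \<sigma>"
  by (simp add: fun_eq_iff)

lemma reversal_adj:
  "\<lbrakk>1 \<le> b; b < k\<rbrakk> \<Longrightarrow> reversal k \<circ> adj b \<circ> reversal k = adj (k - b)"
proof
  fix a
  assume b: "1 \<le> b" "b < k"
  consider "a = k - b" | "a = k - b + 1" | "a \<noteq> k - b" "a \<noteq> k - b + 1" "a \<in> {1..k}" | "a \<notin> {1..k}"
    by blast
  then show "(reversal k \<circ> adj b \<circ> reversal k) a = adj (k - b) a"
  proof cases
    case 1
    then have "reversal k a = b + 1" "reversal k b = k - b + 1" using b by (auto simp: reversal_def)
    then show ?thesis using 1 by (simp add: adj_def)
  next
    case 2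
    then have "reversal k a = b" "reversal k (b + 1) = k - b" using b by (auto simp: reversal_def)
    then show ?thesis using 2 by (simp add: adj_def)
  next
    case 3
    then have "reversal k a = k + 1 - a" "k + 1 - a \<noteq> b" "k + 1 - a \<noteq> b + 1" using b
      by (auto simp: reversal_def)
    then have "adj b (reversal k a) = reversal k a" by (simp add: adj_def)
    then show ?thesis using 3 by (simp add: adj_def)
  next
    case 4
    then have "reversal k a = a" "a \<noteq> b" "a \<noteq> b + 1" "a \<noteq> k - b" "a \<noteq> k - b + 1" using b
      by (auto simp: reversal_def)
    then show ?thesis by (simp add: adj_def)
  qed
qed

text \<open>Inversion followed by conjugation with the reversal matches the permutations of the last
  \<open>k - r\<close> points with those of the first \<open>k - r\<close>.\<close>

lemma sum_permutes_reversal: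
  "(\<Sum>\<sigma> | \<sigma> permutes {r+1..k}. f (reversal k \<circ> inv \<sigma> \<circ> reversal k)) = (\<Sum>\<sigma> | \<sigma> permutes {1..k-r}. f \<sigma>)"
proof -
  have "(\<Sum>\<sigma> | \<sigma> permutes {r+1..k}. f (reversal k \<circ> inv \<sigma> \<circ> reversal k))
    = (\<Sum>\<sigma> | \<sigma> permutes {r+1..k}. f (reversal k \<circ> \<sigma> \<circ> reversal k))"
    by (rule sum_permutations_inverse[symmetric, of "\<lambda>\<sigma>. f (reversal k \<circ> \<sigma> \<circ> reversal k)"])
  also have "\<dots> = (\<Sum>\<sigma> | \<sigma> permutes {1..k-r}. f \<sigma>)"
  proof (rule sum.reindex_bij_witness[of _ "\<lambda>\<sigma>. reversal k \<circ> \<sigma> \<circ> reversal k" "\<lambda>\<sigma>. reversal k \<circ> \<sigma> \<circ> reversal k"])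
    fix \<sigma> assume "\<sigma> \<in> {\<sigma>. \<sigma> permutes {r+1..k}}"
    then show "reversal k \<circ> \<sigma> \<circ> reversal k \<in> {\<sigma>. \<sigma> permutes {1..k-r}}"
      by (simp only: mem_Collect_eq reversal_conj_permutes)
  next
    fix \<sigma> assume "\<sigma> \<in> {\<sigma>. \<sigma> permutes {1..k-r}}"
    then show "reversal k \<circ> \<sigma> \<circ> reversal k \<in> {\<sigma>. \<sigma> permutes {r+1..k}}"
      by (simp only: mem_Collect_eq reversal_conj_permutes')
  qed (rule reversal_conj_conj refl)+
  finally show ?thesis .
qed

lemma cyc_apply: "1 \<le> r \<Longrightarrow> cyc r a = (if a = 1 then r else if 2 \<le> a \<and> a \<le> r then a - 1 else a)"
proof (induction r rule: dec_induct)
  case base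
  show ?case by (simp add: cyc_le_1)
next
  case (step r)
  then show ?case by (auto simp: cyc_Suc adj_def transpose_def)
qed

text \<open>The inverse cycle raises points instead of lowering them; reversing the order of the
  points makes it lower them again, now among the last \<open>r\<close>. Either operation alone
  would produce an inverse cycle.\<close>

lemma reversal_cyc:
  assumes "1 \<le> r" "r \<le> k"
  shows "reversal k \<circ> inv (cyc r) \<circ> reversal k = shift (k - r) (cyc r)"
proof -
  let ?A = "reversal k \<circ> shift (k - r) (cyc r) \<circ> reversal k"
  \<comment> \<open>Multiplying by \<open>cyc r\<close> trades the inverse for an identity that can
    be checked point by point.\<close>
  have id: "?A \<circ> cyc r = id"
  proof
    fix a
    let ?S = "shift (k - r) (cyc r)"
    have c: "cyc r 1 = r" "2 \<le> x \<Longrightarrow> x \<le> r \<Longrightarrow> cyc r x = x - 1" "cyc r 0 = 0" "r < x \<Longrightarrow> cyc r x = x" for x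
      using assms(1) by (simp_all add: cyc_apply)
    have rev: "1 \<le> x \<Longrightarrow> x \<le> k \<Longrightarrow> reversal k x = k + 1 - x" "x = 0 \<or> k < x \<Longrightarrow> reversal k x = x" for x
      by (auto simp: reversal_def)
    have S: "x \<le> k - r \<Longrightarrow> ?S x = x" "\<not> x \<le> k - r \<Longrightarrow> ?S x = cyc r (x - (k - r)) + (k - r)" for x
      by (simp_all add: shift_def)
    consider "a = 0" | "a = 1" | "2 \<le> a" "a \<le> r" | "r < a" "a \<le> k" | "k < a" by linarith
    then have "reversal k (?S (reversal k (cyc r a))) = a"
    proof cases
      case 1
      then show ?thesis by (simp only: c(3) rev(2) S(1) le0 simp_thms)
    next
      case 2
      have "k + 1 - r - (k - r) = 1" "\<not> k + 1 - r \<le> k - r" using assms by auto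
      then have "?S (k + 1 - r) = k" using S(2)[of "k + 1 - r"] c(1) assms by simp
      then show ?thesis using 2 c(1) rev(1)[of r] rev(1)[of k] assms by simp
    next
      case 3
      have r': "reversal k (a - 1) = k + 2 - a" using rev(1)[of "a - 1"] 3 assms by auto
      have "k + 2 - a - (k - r) = r + 2 - a" "\<not> k + 2 - a \<le> k - r" "2 \<le> r + 2 - a" "r + 2 - a \<le> r"
        using 3 assms by auto
      then have "?S (k + 2 - a) = k + 1 - a" using S(2)[of "k + 2 - a"] c(2)[of "r + 2 - a"] 3 assms by auto
      then show ?thesis using c(2)[OF 3] r' rev(1)[of "k + 1 - a"] 3 assms by auto
    next
      case 4
      have "?S (k + 1 - a) = k + 1 - a" using S(1)[of "k + 1 - a"] 4 by auto
      then show ?thesis using c(4)[of a] rev(1)[of a] rev(1)[of "k + 1 - a"] 4 assms by auto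
    next
      case 5
      have "?S a = a" using S(2)[of a] c(4)[of "a - (k - r)"] 5 assms by auto
      then show ?thesis using c(4)[of a] rev(2)[of a] 5 assms by auto
    qed
    then show "(?A \<circ> cyc r) a = id a" by simp
  qed
  have "?A = ?A \<circ> (cyc r \<circ> inv (cyc r))"
    by (simp only: permutes_inv_o(1)[OF cyc_permutes[OF order_refl]] comp_id)
  also have "\<dots> = (?A \<circ> cyc r) \<circ> inv (cyc r)" by (simp only: comp_assoc)
  also have "\<dots> = inv (cyc r)" by (simp only: id id_comp)
  finally have eq: "?A = inv (cyc r)" .
  show ?thesis unfolding eq[symmetric] by (rule reversal_conj_conj)
qed

lemma permutes_permutation: "\<sigma> permutes {a..b::nat} \<Longrightarrow> permutation \<sigma>"
  unfolding permutation_permutes by (rule exI[of _ "{a..b}"]) simp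

lemma sign_reversal_conj:
  assumes "\<sigma> permutes {a..b::nat}"
  shows "sign (reversal k \<circ> inv \<sigma> \<circ> reversal k) = sign \<sigma>"
proof -
  have p: "permutation (reversal k)" "permutation \<sigma>" "permutation (inv \<sigma>)"
    by (rule permutes_permutation, rule reversal_permutes assms permutes_inv[OF assms])+
  have "sign (reversal k \<circ> inv \<sigma> \<circ> reversal k) = sign (reversal k) * sign \<sigma> * sign (reversal k)"
    by (simp only: sign_compose[OF permutation_compose[OF p(1,3)] p(1)] sign_compose[OF p(1,3)] sign_inverse[OF p(2)])
  then show ?thesis by (simp only: mult.assoc mult.left_commute[of "sign (reversal k)" "sign \<sigma>"] sign_idempotent mult_1_right)
qed

lemma sign_adj: "sign (adj i) = - 1"
  unfolding adj_def by (simp add: sign_swap_id)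

lemma sign_adj_comp:
  assumes "\<sigma> permutes {a..b::nat}"
  shows "sign (adj i \<circ> \<sigma>) = - sign \<sigma>" "sign (\<sigma> \<circ> adj i) = - sign \<sigma>"
proof -
  have p: "permutation (adj i)" "permutation \<sigma>"
    using permutes_permutation[OF adj_permutes[of 0 i "Suc i"]] permutes_permutation[OF assms] by auto
  show "sign (adj i \<circ> \<sigma>) = - sign \<sigma>"
    by (simp only: sign_compose[OF p] sign_adj mult_minus1)
  show "sign (\<sigma> \<circ> adj i) = - sign \<sigma>"
    by (simp only: sign_compose[OF p(2,1)] sign_adj mult_minus1_right)
qed

lemma sign_cyc: "1 \<le> r \<Longrightarrow> sign (cyc r) = (- 1) ^ (r - 1)"
proof (induction r rule: dec_induct)
  case base
  show ?case by (simp only: cyc_le_1 order_refl sign_id diff_self_eq_0 power_0)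
next
  case (step j)
  have "sign (cyc (Suc j)) = - sign (cyc j)"
    unfolding cyc_Suc[OF step(1)] by (rule sign_adj_comp(1)[OF cyc_permutes[OF order_refl]])
  then show ?case using step by (cases j) simp_all
qed

context q_super
begin

text \<open>The first \<open>r\<close> entries already stand to the left of the others, so none
  change order. The sign in \<open>mprod_append\<close> is trivial because \<open>\<sigma>\<close>
  preserves the total parity of its block.\<close>

lemma perm_trace_mult:
  assumes \<sigma>: "\<sigma> permutes {1..r}" and \<tau>: "\<tau> permutes {1..s}"
  shows "perm_trace B (r + s) (\<sigma> \<circ> shift r \<tau>) = perm_trace B r \<sigma> * perm_trace B s \<tau>"
proof -
  have "perm_trace B (r + s) (\<sigma> \<circ> shift r \<tau>)
    = (\<Sum>J\<in>indices r. \<Sum>K\<in>indices s. scale (ksgn (lpar J) * coc \<sigma> J) (mprod B J (pact \<sigma> J))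
        * scale (ksgn (lpar K) * coc \<tau> K) (mprod B K (pact \<tau> K)))"
    unfolding perm_trace_def sum_indices_add
  proof (intro sum.cong refl)
    fix J K assume "J \<in> indices r" "K \<in> indices s"
    then have len: "length J = r" "length K = s" by (auto simp: length_indices)
    have s': "\<sigma> permutes {1..length J}" "\<tau> permutes {1..length K}" using \<sigma> \<tau> by (simp_all only: len)
    have p: "\<sigma> permutes {1..length (J @ K)}" "shift r \<tau> permutes {1..length (J @ K)}"
      using permutes_atLeastAtMost_mono[OF \<sigma>, of 1 "r + s"]
        permutes_atLeastAtMost_mono[OF shift_permutes[OF \<tau>, of r], of 1 "r + s"] len by auto
    have act: "pact (\<sigma> \<circ> shift r \<tau>) (J @ K) = pact \<sigma> J @ pact \<tau> K"
      using s' len by (simp only: pact_comp[OF p] pact_shift pact_append)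
    have c: "coc (\<sigma> \<circ> shift r \<tau>) (J @ K) = coc \<sigma> J * coc \<tau> K"
      using s' len by (simp only: coc_comp[OF p] pact_shift coc_append coc_shift)
    have l: "lpar (pact \<sigma> J) = lpar J" using s' by (intro lpar_pact)
    show "scale (ksgn (lpar (J @ K)) * coc (\<sigma> \<circ> shift r \<tau>) (J @ K)) (mprod B (J @ K) (pact (\<sigma> \<circ> shift r \<tau>) (J @ K)))
      = scale (ksgn (lpar J) * coc \<sigma> J) (mprod B J (pact \<sigma> J))
        * scale (ksgn (lpar K) * coc \<tau> K) (mprod B K (pact \<tau> K))"
      unfolding act c
      by (simp add: mprod_append l ksgn_add scale_mult_left[symmetric] scale_mult_right[symmetric] ac_simps)
  qed
  also have "\<dots> = perm_trace B r \<sigma> * perm_trace B s \<tau>"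
    by (simp only: perm_trace_def sum_product)
  finally show ?thesis .
qed

section \<open>The powers M^[k] as sums over index paths\<close>

lemma mstar_entry:
  assumes "super_matrix B" "super_matrix C" "j \<in> {1..m + n}" "l \<in> {1..m + n}"
  shows "mstar B C j l = (\<Sum>i\<in>{1..m + n}. scale (q powi sgn (int i - int j)) (B j i * C i l))"
proof -
  let ?Z = "Pq 2 1 \<star> place 2 1 B \<star> place 2 2 C"
  have ind: "[a, b] \<in> indices 2 \<longleftrightarrow> a \<in> {1..m + n} \<and> b \<in> {1..m + n}" for a b
    by (auto simp: indices_def)
  have sw: "pact (adj (Suc 0)) [a, b] = [b, a]" for a b :: nat
    using pact_adj_append[of "[]" a b "[]"] by simp
  have ev: "even_tensor 2 (place 2 1 B)" "even_tensor 2 (place 2 2 C)"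
    using assms by (auto intro: even_place)
  \<comment> \<open>In this order: the signs of \<open>matrix_of\<close>, of the supertrace, of
    undoing the gauge, of \<open>pcoef\<close>, and of the product of the two placed matrices. They
    cancel, so \<open>mstar\<close> is the matrix product weighted by powers of
    \<open>q\<close>.\<close>
  have sg: "ksgn (b * c + c) * (ksgn a * (ksgn ((b + c) * c) * (ksgn (a * b) * ksgn ((b + a) * a)))) = (1 :: complex)"
    for a b c by (cases a; cases b; cases c) (simp_all add: ksgn_def)
  have Z: "ksgn (par j * par l + par l) * (ksgn (par i) * ?Z [i, j] [i, l])
      = scale (q powi sgn (int i - int j)) (B j i * C i l)"
    if i: "i \<in> {1..m + n}" for i
  proof -
    have "gauge ?Z [i, j] [i, l] = scale (pcoef i j) (gauge (place 2 1 B \<star> place 2 2 C) [j, i] [i, l])"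
      using i assms gauge_Pq_tmul[OF even_tmul[OF ev], of "[i, j]" "[i, l]" 1]
      by (subst gauge_tmul_assoc[OF ev]) (simp_all add: ind sw)
    also have "\<dots> = scale (pcoef i j * ksgn ((par j + par i) * par i)) (B j i * C i l)"
      using i assms by (simp only: gauge_two_places scale_scale)
    finally have g: "gauge ?Z [i, j] [i, l] = scale (pcoef i j * ksgn ((par j + par i) * par i)) (B j i * C i l)" .
    have "gexp [i, j] [i, l] = (par j + par l) * par l" by simp
    then have "?Z [i, j] [i, l] = scale (ksgn ((par j + par l) * par l) * (pcoef i j * ksgn ((par j + par i) * par i))) (B j i * C i l)"
      using ungauge[of ?Z "[i, j]" "[i, l]"] g by simp
    then have "ksgn (par j * par l + par l) * (ksgn (par i) * ?Z [i, j] [i, l])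
      = scale (q powi sgn (int i - int j) * (ksgn (par j * par l + par l) * (ksgn (par i) * (ksgn ((par j + par l) * par l) *
          (ksgn (par i * par j) * ksgn ((par j + par i) * par i)))))) (B j i * C i l)"
      by (simp only: scale_ksgn scale_scale pcoef_def ac_simps)
    then show ?thesis by (simp only: sg mult_1_right)
  qed
  show ?thesis
    unfolding mstar_def matrix_of_def str_first_def sum_distrib_left
    by (intro sum.cong refl) (rule Z)
qed

lemma super_matrix_mstar:
  assumes "super_matrix B" "super_matrix C"
  shows "super_matrix (mstar B C)"
  unfolding super_matrix_def
proof (intro ballI)
  fix j l assume jl: "j \<in> {1..m + n}" "l \<in> {1..m + n}"
  have "scale c (B j i * C i l) \<in> grade (par j + par l)" if "i \<in> {1..m + n}" for i c
  proof -
    have "B j i * C i l \<in> grade ((par j + par i) + (par i + par l))"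
      using assms jl that by (intro mult_in_grade) (auto simp: super_matrix_def)
    then show ?thesis by (simp add: add.assoc scale_in_grade)
  qed
  then show "mstar B C j l \<in> grade (par j + par l)"
    unfolding mstar_entry[OF assms jl] by (intro subspace_sum subspace_grade)
qed

fun chain :: "(nat \<Rightarrow> nat \<Rightarrow> 'r) \<Rightarrow> nat \<Rightarrow> nat list \<Rightarrow> nat \<Rightarrow> 'r"
  where
    "chain B j [] l = B j l"
  | "chain B j (i # I) l = B j i * chain B i I l"

lemma chain_snoc: "chain B j (I @ [i]) l = chain B j I i * B i l"
  by (induction I arbitrary: j) (simp_all add: mult.assoc)

lemma super_matrix_mpow: "super_matrix B \<Longrightarrow> super_matrix (mpow B (Suc r))"
  by (induction r) (simp_all add: super_matrix_mstar)

text \<open>Multiplying by \<open>B\<close> on the right never changes the row index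
  \<open>j\<close>, so each intermediate index is compared with \<open>j\<close> and not with its
  neighbour on the path.\<close>

lemma mpow_chain:
  assumes "super_matrix B" "j \<in> {1..m + n}" "l \<in> {1..m + n}"
  shows "mpow B (Suc r) j l =
    (\<Sum>I\<in>indices r. scale (prod_list (map (\<lambda>i. q powi sgn (int i - int j)) I)) (chain B j I l))"
  using assms(3)
proof (induction r arbitrary: l)
  case 0
  show ?case by simp
next
  case (Suc r)
  have "mpow B (Suc (Suc r)) j l
    = (\<Sum>i\<in>{1..m + n}. scale (q powi sgn (int i - int j)) (mpow B (Suc r) j i * B i l))"
    using mstar_entry[OF super_matrix_mpow[OF assms(1)] assms(1,2) Suc.prems] by simp
  also have "\<dots> = (\<Sum>i\<in>{1..m + n}. \<Sum>I\<in>indices r.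
      scale (prod_list (map (\<lambda>i. q powi sgn (int i - int j)) (I @ [i]))) (chain B j (I @ [i]) l))"
    by (intro sum.cong refl)
       (simp add: Suc.IH sum_distrib_right scale_sum_right scale_mult_left[symmetric] chain_snoc mult.commute)
  also have "\<dots> = (\<Sum>I\<in>indices (Suc r).
      scale (prod_list (map (\<lambda>i. q powi sgn (int i - int j)) I)) (chain B j I l))"
    unfolding sum_indices_snoc by (rule sum.swap)
  finally show ?case .
qed

text \<open>Rows \<open>j # I\<close> against columns \<open>I @ [l]\<close> make each column index
  the next row index, so the word is a path from \<open>j\<close> to \<open>l\<close>.\<close>

lemma mprod_rotate:
  "mprod B (j # I) (I @ [l]) = scale (ksgn (lpar I * (1 + par j))) (chain B j I l)"
proof (induction I arbitrary: j)
  case Nil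
  show ?case by simp
next
  case (Cons i I)
  have s: "ksgn ((a + b) * (b + c)) * ksgn (c * (1 + b)) = (ksgn ((b + c) * (1 + a)) :: complex)" for a b c
    by (cases a; cases b; cases c) (simp_all add: ksgn_def)
  have "mprod B (j # i # I) ((i # I) @ [l]) = scale (ksgn ((par j + par i) * lpar (i # I))) (B j i * mprod B (i # I) (I @ [l]))"
    by simp
  then show ?case
    by (simp add: Cons.IH scale_mult_right[symmetric] s del: mprod.simps)
qed

text \<open>Carrying \<open>j\<close> past \<open>I\<close> by the cycle collects the scalars
  \<open>pcoef x j\<close>, whose powers of \<open>q\<close> are the path weights of
  \<open>mpow_chain\<close>.\<close>

lemma str_mpow:
  assumes "super_matrix B"
  shows "str (mpow B (Suc r)) = perm_trace B (Suc r) (cyc (Suc r))"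
proof -
  \<comment> \<open>With \<open>a\<close> the parity of \<open>j\<close> and \<open>b\<close> that
    of \<open>I\<close>: the signs of the full supertrace, the cocycle and the rotated word reduce
    to that of the supertrace over \<open>j\<close> alone.\<close>
  have sg: "ksgn (a + b) * ksgn (b * a) * ksgn (b * (1 + a)) = (ksgn a :: complex)" for a b
    by (cases a; cases b) (simp_all add: ksgn_def)
  have pr: "prod_list (map (\<lambda>x. pcoef x j) I) = ksgn (lpar I * par j) * prod_list (map (\<lambda>i. q powi sgn (int i - int j)) I)"
    for I j by (induction I) (simp_all add: pcoef_def ksgn_add distrib_right)
  have "perm_trace B (Suc r) (cyc (Suc r))
    = (\<Sum>j\<in>{1..m + n}. \<Sum>I\<in>indices r.
        scale (ksgn (par j)) (scale (prod_list (map (\<lambda>i. q powi sgn (int i - int j)) I)) (chain B j I j)))"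
    unfolding perm_trace_def sum_indices_Suc
  proof (intro sum.cong refl)
    fix j I assume "I \<in> indices r"
    then have len: "length I = r" by (rule length_indices)
    have c: "pact (cyc (Suc r)) (j # I) = I @ [j]"
      "coc (cyc (Suc r)) (j # I) = prod_list (map (\<lambda>x. pcoef x j) I)"
      using cyc_act[of I j "[]"] len by auto
    have "ksgn (par j + lpar I) * (ksgn (lpar I * par j) * P) * ksgn (lpar I * (1 + par j)) = ksgn (par j) * P" for P :: complex
      unfolding sg[of "par j" "lpar I", symmetric] by (simp only: ac_simps)
    then show "scale (ksgn (lpar (j # I)) * coc (cyc (Suc r)) (j # I)) (mprod B (j # I) (pact (cyc (Suc r)) (j # I)))
      = scale (ksgn (par j)) (scale (prod_list (map (\<lambda>i. q powi sgn (int i - int j)) I)) (chain B j I j))"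
      unfolding c mprod_rotate pr by (simp only: scale_scale lpar_simps)
  qed
  also have "\<dots> = str (mpow B (Suc r))"
    unfolding str_def
    by (intro sum.cong refl) (simp only: mpow_chain[OF assms] scale_ksgn scale_sum_right)
  finally show ?thesis ..
qed


lemma double_cancel:
  fixes x y :: 'r
  assumes "x + x = y + y"
  shows "x = y"
proof -
  have "z + z = scale 2 z" for z :: 'r
    using scale_left_distrib[of 1 1 z] by simp
  then show ?thesis using assms by simp
qed

lemma of_nat_mult_scale: "of_nat k * x = scale (of_nat k) x"
  by (induction k) (simp_all add: distrib_right scale_left_distrib)

text \<open>The factor \<open>k\<close> from the derivative, the \<open>1 / k!\<close> of the
  symmetrizer and the weight \<open>(k-1)...(k-r+1)\<close> combine to \<open>1 / (k-r)!\<close>,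
  the normalisation for the remaining \<open>k - r\<close> points.\<close>

lemma scale_decomposition:
  fixes E :: "nat \<Rightarrow> 'r"
  assumes "k \<ge> 1" "X = (\<Sum>r\<in>{1..k}. of_nat (\<Prod>i\<in>{1..<r}. k - i) * E r)"
  shows "of_nat k * scale (1 / fact k) X = (\<Sum>r\<in>{1..k}. scale (1 / fact (k - r)) (E r))"
  unfolding assms(2) scale_sum_right sum_distrib_left
proof (rule sum.cong[OF refl])
  fix r assume r: "r \<in> {1..k}"
  let ?w = "(\<Prod>i\<in>{1..<r}. k - i)"
  have "of_nat (?w * fact (k - r)) = (of_nat (fact (k - 1)) :: complex)"
    using prod_diff_mult_fact[of r k] r by (simp only: atLeastAtMost_iff)
  then have "of_nat ?w * fact (k - r) = (fact (k - 1) :: complex)" by (simp only: of_nat_mult of_nat_fact)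
  moreover have "(fact k :: complex) = of_nat k * fact (k - 1)" using assms(1) by (simp add: fact_reduce)
  ultimately have "of_nat k * (1 / fact k) * of_nat ?w = (1 / fact (k - r) :: complex)"
    using assms(1) by (simp add: field_simps)
  then show "of_nat k * scale (1 / fact k) (of_nat ?w * E r) = scale (1 / fact (k - r)) (E r)"
    by (simp only: of_nat_mult_scale scale_scale mult.assoc)
qed

section \<open>Newton's identities\<close>

definition hom_sum :: "(nat \<Rightarrow> nat \<Rightarrow> 'r) \<Rightarrow> nat \<Rightarrow> 'r"
  where "hom_sum B k = scale (1 / fact k) (\<Sum>\<sigma> | \<sigma> permutes {1..k}. perm_trace B k \<sigma>)"

definition elem_sum :: "(nat \<Rightarrow> nat \<Rightarrow> 'r) \<Rightarrow> nat \<Rightarrow> 'r"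
  where "elem_sum B k = scale (1 / fact k)
    (\<Sum>\<sigma> | \<sigma> permutes {1..k}. scale (of_int (sign \<sigma>)) (perm_trace B k \<sigma>))"

text \<open>The cycle occupies the first \<open>r\<close> points and the sum runs over permutations
  of the others, so multiplicativity puts the power of \<open>B\<close> on the left.\<close>

lemma newton_hom:
  assumes M: "q_super_manin B" and k: "k \<ge> 1"
  shows "of_nat k * hom_sum B k = (\<Sum>r\<in>{1..k}. str (mpow B r) * hom_sum B (k - r))"
proof -
  interpret E: exchange k "perm_trace B k"
    by unfold_locales (rule double_cancel, assumption, rule perm_trace_exchange[OF M])
  have B: "super_matrix B" using M by (simp add: q_super_manin_def)
  have "of_nat k * hom_sum B k
    = (\<Sum>r\<in>{1..k}. scale (1 / fact (k - r)) (\<Sum>\<sigma> | \<sigma> permutes {Suc r..k}. perm_trace B k (\<sigma> \<circ> cyc r)))"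
    unfolding hom_sum_def by (rule scale_decomposition[OF k E.sum_decomposition[OF k]])
  also have "\<dots> = (\<Sum>r\<in>{1..k}. str (mpow B r) * hom_sum B (k - r))"
  proof (rule sum.cong[OF refl])
    fix r assume r: "r \<in> {1..k}"
    define s where "s = k - r"
    have k': "k = r + s" using r by (simp add: s_def)
    have c: "cyc r permutes {1..r}" by (rule cyc_permutes) simp
    have "(\<Sum>\<sigma> | \<sigma> permutes {Suc r..k}. perm_trace B k (\<sigma> \<circ> cyc r))
      = (\<Sum>\<sigma> | \<sigma> permutes {1..s}. perm_trace B k (shift r \<sigma> \<circ> cyc r))"
      unfolding k' Suc_eq_plus1 by (rule sum_permutes_shift)
    also have "\<dots> = (\<Sum>\<sigma> | \<sigma> permutes {1..s}. perm_trace B r (cyc r) * perm_trace B s \<sigma>)"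
      by (intro sum.cong refl) (simp only: mem_Collect_eq shift_commute[OF c] k' perm_trace_mult[OF c])
    also have "\<dots> = str (mpow B r) * (\<Sum>\<sigma> | \<sigma> permutes {1..s}. perm_trace B s \<sigma>)"
      using r str_mpow[OF B, of "r - 1"] by (simp add: sum_distrib_left)
    finally show "scale (1 / fact (k - r)) (\<Sum>\<sigma> | \<sigma> permutes {Suc r..k}. perm_trace B k (\<sigma> \<circ> cyc r))
      = str (mpow B r) * hom_sum B (k - r)"
      by (simp only: hom_sum_def s_def[symmetric] scale_mult_right)
  qed
  finally show ?thesis .
qed

text \<open>The twist puts the cycle on the last \<open>r\<close> points and hence the power of
  \<open>B\<close> on the right; \<open>(-1)^(r-1)\<close> is the sign of the cycle.\<close>

lemma newton_elem:
  assumes M: "q_super_manin B" and k: "k \<ge> 1"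
  shows "of_nat k * elem_sum B k = (\<Sum>r\<in>{1..k}. elem_sum B (k - r) * scale ((- 1) ^ (r - 1)) (str (mpow B r)))"
proof -
  let ?rev = "\<lambda>\<sigma>. reversal k \<circ> inv \<sigma> \<circ> reversal k"
  let ?\<tau> = "\<lambda>\<sigma>. scale (of_int (sign \<sigma>)) (perm_trace B k (?rev \<sigma>))"
  have rev_comp: "?rev (\<sigma> \<circ> \<rho>) = ?rev \<rho> \<circ> ?rev \<sigma>" if "\<sigma> permutes S" "\<rho> permutes T" for \<sigma> \<rho> S T
  proof -
    have "inv (\<sigma> \<circ> \<rho>) = inv \<rho> \<circ> inv \<sigma>" using that by (intro o_inv_distrib permutes_bij)
    then show ?thesis by (simp add: fun_eq_iff)
  qed
  have inv_adj: "inv (adj b) = adj b" for b by (simp add: adj_def)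
  interpret E: exchange k ?\<tau>
  proof (unfold_locales, rule double_cancel, assumption)
    fix \<sigma> b assume \<sigma>: "\<sigma> permutes {1..k}" and b: "1 \<le> b" "b < k"
    let ?x = "?rev \<sigma>"
    have a: "adj b permutes {1..k}" using b by (intro adj_permutes) auto
    have x: "?x permutes {1..k}"
      using reversal_conj_permutes[of "inv \<sigma>" 0 k] permutes_inv[OF \<sigma>] by simp
    have r: "?rev (adj b) = adj (k - b)" using reversal_adj[OF b] by (simp only: inv_adj)
    have \<sigma>a: "\<sigma> \<circ> adj b permutes {1..k}" using \<sigma> a by (intro permutes_compose)
    have revs: "?rev (adj b \<circ> \<sigma>) = ?x \<circ> adj (k - b)" "?rev (\<sigma> \<circ> adj b) = adj (k - b) \<circ> ?x"
      "?rev (adj b \<circ> (\<sigma> \<circ> adj b)) = adj (k - b) \<circ> (?x \<circ> adj (k - b))"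
      by (simp_all only: rev_comp[OF a \<sigma>] rev_comp[OF \<sigma> a] rev_comp[OF a \<sigma>a] r)
        (simp only: comp_assoc)
    have sg: "sign (adj b \<circ> \<sigma>) = - sign \<sigma>" "sign (\<sigma> \<circ> adj b) = - sign \<sigma>"
      "sign (adj b \<circ> (\<sigma> \<circ> adj b)) = sign \<sigma>"
      by (simp_all only: sign_adj_comp[OF \<sigma>] sign_adj_comp[OF \<sigma>a] minus_minus)
    have "perm_trace B k ?x + perm_trace B k (adj (k - b) \<circ> ?x)
      = perm_trace B k (?x \<circ> adj (k - b)) + perm_trace B k (adj (k - b) \<circ> (?x \<circ> adj (k - b)))"
      by (rule perm_trace_exchange[OF M x]) (use b in auto)
    \<comment> \<open>The two terms with a single \<open>adj\<close> acquire a minus sign and trade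
      sides. That this is again the exchange relation depends on the inverse, which has turned the
      left factor \<open>adj b\<close> into a right one and conversely.\<close>
    then have "perm_trace B k ?x - perm_trace B k (?x \<circ> adj (k - b))
      = perm_trace B k (adj (k - b) \<circ> (?x \<circ> adj (k - b))) - perm_trace B k (adj (k - b) \<circ> ?x)"
      by (simp only: algebra_simps)
    from arg_cong[OF this, of "scale (of_int (sign \<sigma>))"]
    show "?\<tau> \<sigma> + ?\<tau> (adj b \<circ> \<sigma>) = ?\<tau> (\<sigma> \<circ> adj b) + ?\<tau> (adj b \<circ> (\<sigma> \<circ> adj b))"
      unfolding revs sg by (simp only: of_int_minus scale_minus_left scale_right_diff_distrib) (simp only: diff_conv_add_uminus ac_simps)
  qed
  have B: "super_matrix B" using M by (simp add: q_super_manin_def)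
  \<comment> \<open>Over the whole group the twist permutes the summands and preserves their
    signs.\<close>
  have id_case: "(\<Sum>\<sigma> | \<sigma> permutes {1..k}. ?\<tau> \<sigma>)
      = (\<Sum>\<sigma> | \<sigma> permutes {1..k}. scale (of_int (sign \<sigma>)) (perm_trace B k \<sigma>))"
  proof -
    have "(\<Sum>\<sigma> | \<sigma> permutes {1..k}. ?\<tau> \<sigma>)
      = (\<Sum>\<sigma> | \<sigma> permutes {0+1..k}. scale (of_int (sign (?rev \<sigma>))) (perm_trace B k (?rev \<sigma>)))"
      by (rule sum.cong) (simp_all add: sign_reversal_conj)
    also have "\<dots> = (\<Sum>\<sigma> | \<sigma> permutes {1..k - 0}. scale (of_int (sign \<sigma>)) (perm_trace B k \<sigma>))"
      by (rule sum_permutes_reversal)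
    finally show ?thesis by simp
  qed
  have "of_nat k * elem_sum B k
    = (\<Sum>r\<in>{1..k}. scale (1 / fact (k - r)) (\<Sum>\<sigma> | \<sigma> permutes {Suc r..k}. ?\<tau> (\<sigma> \<circ> cyc r)))"
    unfolding elem_sum_def id_case[symmetric] by (rule scale_decomposition[OF k E.sum_decomposition[OF k]])
  also have "\<dots> = (\<Sum>r\<in>{1..k}. elem_sum B (k - r) * scale ((- 1) ^ (r - 1)) (str (mpow B r)))"
  proof (rule sum.cong[OF refl])
    fix r assume r: "r \<in> {1..k}"
    define s where "s = k - r"
    have k': "k = s + r" "k - s = r" using r by (auto simp: s_def)
    have c: "cyc r permutes {1..r}" by (rule cyc_permutes) simp
    let ?c = "(- 1) ^ (r - 1) :: complex"
    have "(\<Sum>\<sigma> | \<sigma> permutes {Suc r..k}. ?\<tau> (\<sigma> \<circ> cyc r))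
      = (\<Sum>\<sigma> | \<sigma> permutes {r+1..k}. scale ?c (scale (of_int (sign (?rev \<sigma>))) (perm_trace B k (?rev \<sigma> \<circ> shift s (cyc r)))))"
    proof (rule sum.cong)
      fix \<sigma> assume "\<sigma> \<in> {\<sigma>. \<sigma> permutes {r+1..k}}"
      then have \<sigma>: "\<sigma> permutes {r+1..k}" by simp
      have "?rev (cyc r) = shift s (cyc r)" unfolding s_def using r by (intro reversal_cyc) auto
      then have "?rev (\<sigma> \<circ> cyc r) = shift s (cyc r) \<circ> ?rev \<sigma>" by (simp only: rev_comp[OF \<sigma> c])
      also have "\<dots> = ?rev \<sigma> \<circ> shift s (cyc r)"
        unfolding s_def by (rule shift_commute[OF reversal_conj_permutes c]) (rule permutes_inv[OF \<sigma>])
      finally have rv: "?rev (\<sigma> \<circ> cyc r) = ?rev \<sigma> \<circ> shift s (cyc r)" .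
      have "sign (\<sigma> \<circ> cyc r) = sign \<sigma> * sign (cyc r)"
        by (rule sign_compose[OF permutes_permutation[OF \<sigma>] permutes_permutation[OF c]])
      also have "\<dots> = sign (?rev \<sigma>) * (- 1) ^ (r - 1)"
        using r by (simp add: sign_cyc sign_reversal_conj[OF \<sigma>])
      finally show "?\<tau> (\<sigma> \<circ> cyc r) = scale ?c (scale (of_int (sign (?rev \<sigma>))) (perm_trace B k (?rev \<sigma> \<circ> shift s (cyc r))))"
        unfolding rv by (simp only: of_int_mult of_int_power of_int_minus of_int_1 scale_scale mult.commute)
    qed simp
    also have "\<dots> = (\<Sum>\<sigma> | \<sigma> permutes {1..k - r}. scale ?c (scale (of_int (sign \<sigma>)) (perm_trace B k (\<sigma> \<circ> shift s (cyc r)))))"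
      by (rule sum_permutes_reversal)
    also have "\<dots> = (\<Sum>\<sigma> | \<sigma> permutes {1..s}. scale (of_int (sign \<sigma>)) (perm_trace B s \<sigma>) * scale ?c (perm_trace B r (cyc r)))"
      unfolding s_def[symmetric]
      by (intro sum.cong refl)
         (simp only: mem_Collect_eq k'(1) perm_trace_mult[OF _ c] scale_scale scale_mult_left[symmetric] scale_mult_right[symmetric] mult.commute)
    also have "\<dots> = (\<Sum>\<sigma> | \<sigma> permutes {1..s}. scale (of_int (sign \<sigma>)) (perm_trace B s \<sigma>)) * scale ?c (str (mpow B r))"
      using r str_mpow[OF B, of "r - 1"] by (simp add: sum_distrib_right)
    finally show "scale (1 / fact (k - r)) (\<Sum>\<sigma> | \<sigma> permutes {Suc r..k}. ?\<tau> (\<sigma> \<circ> cyc r))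
      = elem_sum B (k - r) * scale ?c (str (mpow B r))"
      by (simp only: elem_sum_def s_def[symmetric] scale_mult_left)
  qed
  finally show ?thesis .
qed

lemma S_series_nth: "super_matrix B \<Longrightarrow> fps_nth (S_series B) k = hom_sum B k"
  using str_all_perm_sum[of B k "1 / fact k" "\<lambda>_. 1"]
  by (simp add: S_series_def Hsym_def hom_sum_def tscale_def)

lemma A_series_nth: "super_matrix B \<Longrightarrow> fps_nth (A_series B) k = (- 1) ^ k * elem_sum B k"
  using str_all_perm_sum[of B k "1 / fact k" "\<lambda>\<sigma>. of_int (sign \<sigma>)"]
  by (simp add: A_series_def Asym_def elem_sum_def)

lemma fps_deriv_S_series:
  assumes M: "q_super_manin B"
  shows "fps_deriv (S_series B) = T_series B * S_series B"
proof (rule fps_ext)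
  fix j
  have B: "super_matrix B" using M by (simp add: q_super_manin_def)
  have "fps_nth (fps_deriv (S_series B)) j = of_nat (Suc j) * hom_sum B (Suc j)"
    by (simp add: S_series_nth[OF B])
  also have "\<dots> = (\<Sum>r=1..Suc j. str (mpow B r) * hom_sum B (Suc j - r))"
    by (rule newton_hom[OF M]) simp
  also have "\<dots> = (\<Sum>i=0..j. str (mpow B (Suc i)) * hom_sum B (j - i))"
    unfolding One_nat_def by (subst sum.shift_bounds_cl_Suc_ivl) simp
  also have "\<dots> = fps_nth (T_series B * S_series B) j"
    by (simp add: fps_mult_nth T_series_def S_series_nth[OF B])
  finally show "fps_nth (fps_deriv (S_series B)) j = fps_nth (T_series B * S_series B) j" .
qed

lemma fps_deriv_A_series:
  assumes M: "q_super_manin B"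
  shows "fps_deriv (A_series B) = - (A_series B * T_series B)"
proof (rule fps_ext)
  fix j
  have B: "super_matrix B" using M by (simp add: q_super_manin_def)
  have pw: "(- 1) ^ i * x = scale ((- 1) ^ i) x" for i and x :: 'r
    by (cases "even i") simp_all
  have "fps_nth (fps_deriv (A_series B)) j = scale ((- 1) ^ Suc j) (of_nat (Suc j) * elem_sum B (Suc j))"
    by (simp only: fps_deriv_nth A_series_nth[OF B] pw scale_mult_right Suc_eq_plus1)
  also have "\<dots> = (\<Sum>r\<in>{1..Suc j}. scale ((- 1) ^ Suc j) (elem_sum B (Suc j - r) * scale ((- 1) ^ (r - 1)) (str (mpow B r))))"
    by (subst newton_elem[OF M]) (simp_all only: scale_sum_right)
  also have "\<dots> = (\<Sum>i\<in>{0..j}. - (scale ((- 1) ^ i) (elem_sum B i) * str (mpow B (Suc (j - i)))))"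
  proof (rule sum.reindex_bij_witness[of _ "\<lambda>i. Suc j - i" "\<lambda>r. Suc j - r"])
    fix r assume r: "r \<in> {1..Suc j}"
    define i where "i = Suc j - r"
    have *: "Suc (j - i) = r" "j = i + (r - 1)" using r by (auto simp: i_def)
    \<comment> \<open>As \<open>j = i + (r - 1)\<close>, the two copies of \<open>(-1)^(r-1)\<close>
      cancel; the surplus factor in \<open>Suc j\<close> is the minus sign of the identity for
      A(t).\<close>
    have "(- 1) ^ Suc j * (- 1) ^ (r - 1) = - ((- 1) ^ i :: complex)"
      unfolding *(2) by (simp add: power_add mult.assoc flip: power_mult_distrib)
    then show "- (scale ((- 1) ^ (Suc j - r)) (elem_sum B (Suc j - r)) * str (mpow B (Suc (j - (Suc j - r)))))
      = scale ((- 1) ^ Suc j) (elem_sum B (Suc j - r) * scale ((- 1) ^ (r - 1)) (str (mpow B r)))"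
      unfolding i_def[symmetric] *(1)
      by (simp only: scale_mult_right[symmetric] scale_mult_left[symmetric] scale_scale scale_minus_left)
  qed auto
  also have "\<dots> = fps_nth (- (A_series B * T_series B)) j"
    by (simp add: fps_mult_nth T_series_def A_series_nth[OF B] pw sum_negf del: mpow.simps)
  finally show "fps_nth (fps_deriv (A_series B)) j = fps_nth (- (A_series B * T_series B)) j" .
qed

end

theorem theorem2p5:
  fixes scale :: "complex \<Rightarrow> 'r::ring_1 \<Rightarrow> 'r"
    and grade :: "bit \<Rightarrow> 'r set"
    and m n :: nat and q :: complex
    and M :: "nat \<Rightarrow> nat \<Rightarrow> 'r"
  assumes "q_super scale grade q"
    and "q_super.q_super_manin scale grade m n q M"
  shows "fps_deriv (q_super.A_series scale grade m n q M)
           = - (q_super.A_series scale grade m n q M * q_super.T_series scale grade m n q M)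
    \<and> fps_deriv (q_super.S_series scale grade m n q M)
           = q_super.T_series scale grade m n q M * q_super.S_series scale grade m n q M"
  using q_super.fps_deriv_A_series[OF assms] q_super.fps_deriv_S_series[OF assms] by (rule conjI)

end
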